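(* Let $Q\in L^2_{\mathrm{loc}}(\mathbb{R})$ be real-valued, let $E_0=\inf\sigma(H_Q)$, and suppose $H_Q$ has a positive ground state $\psi$ (a positive distributional solution of $-\psi''+Q\psi=E_0\psi$) such that $\int_0^\infty\psi(t)^{-2}\,dt=\infty$ and $\int_{-\infty}^0\psi(t)^{-2}\,dt=\infty$. If $V\in L^2_{\mathrm{loc}}(\mathbb{R})$ is real-valued and both $H_{Q+V}$ and $H_{Q-V}$ are bounded below by $E_0$ (in the quadratic form sense on $C_c^\infty(\mathbb{R})$), then $V\equiv0$.
   Context: For a real potential $W$ on $\mathbb{R}$, $H_W=-\frac{d^2}{dx^2}+W$ is the Schrödinger operator on $L^2(\mathbb{R})$, defined through its quadratic form $\int|\phi'|^2+W|\phi|^2$. The ground-state energy is the infimum of the spectrum. *)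

theory Defs
  imports "HOL-Analysis.Analysis"
begin

definition L2loc :: "(real \<Rightarrow> real) \<Rightarrow> bool" where
  "L2loc W \<longleftrightarrow> W \<in> borel_measurable borel \<and>
     (\<forall>a b. (\<integral>\<^sup>+ x\<in>{a..b}. ennreal ((W x)\<^sup>2) \<partial>lborel) < \<infinity>)"

definition L1loc :: "(real \<Rightarrow> real) \<Rightarrow> bool" where
  "L1loc f \<longleftrightarrow> (\<forall>a b. set_integrable lborel {a..b} f)"

definition test_fun :: "(real \<Rightarrow> 'a::real_normed_vector) \<Rightarrow> bool" where
  "test_fun \<phi> \<longleftrightarrow>
     (\<exists>D :: nat \<Rightarrow> real \<Rightarrow> 'a. D 0 = \<phi> \<and>
        (\<forall>n x. (D n has_vector_derivative D (Suc n) x) (at x))) \<and>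
     bounded {x. \<phi> x \<noteq> 0}"

text \<open>Quadratic form of H_W = -d^2/dx^2 + W on a (complex) test function.\<close>
definition qform :: "(real \<Rightarrow> real) \<Rightarrow> (real \<Rightarrow> complex) \<Rightarrow> real" where
  "qform W \<phi> = (\<integral>x. (cmod (vector_derivative \<phi> (at x)))\<^sup>2 + W x * (cmod (\<phi> x))\<^sup>2 \<partial>lborel)"

definition l2norm_sq :: "(real \<Rightarrow> complex) \<Rightarrow> real" where
  "l2norm_sq \<phi> = (\<integral>x. (cmod (\<phi> x))\<^sup>2 \<partial>lborel)"

text \<open>The set of values of the quadratic form on normalized test functions;
  H_W is semibounded iff this set is bounded below, and then the ground state
  energy inf sigma(H_W) is its infimum.\<close>
definition rayleigh_vals :: "(real \<Rightarrow> real) \<Rightarrow> real set" where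
  "rayleigh_vals W = {qform W \<phi> | \<phi>. test_fun \<phi> \<and> l2norm_sq \<phi> = 1}"

definition ground_energy :: "(real \<Rightarrow> real) \<Rightarrow> real" where
  "ground_energy W = Inf (rayleigh_vals W)"

definition form_bounded_below :: "(real \<Rightarrow> real) \<Rightarrow> real \<Rightarrow> bool" where
  "form_bounded_below W E \<longleftrightarrow> (\<forall>\<phi>. test_fun \<phi> \<longrightarrow> qform W \<phi> \<ge> E * l2norm_sq \<phi>)"

definition distr_solution :: "(real \<Rightarrow> real) \<Rightarrow> real \<Rightarrow> (real \<Rightarrow> real) \<Rightarrow> bool" where
  "distr_solution W E \<psi> \<longleftrightarrow>
     \<psi> \<in> borel_measurable borel \<and> L1loc \<psi> \<and> L1loc (\<lambda>x. W x * \<psi> x) \<and>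
     (\<forall>\<phi>::real \<Rightarrow> real. test_fun \<phi> \<longrightarrow>
        (\<integral>x. - \<psi> x * deriv (deriv \<phi>) x + (W x - E) * \<psi> x * \<phi> x \<partial>lborel) = 0)"

end

theory Submission
  imports Defs
begin

text \<open>The solution \<open>\<psi>\<close> agrees almost everywhere with a positive \<open>C\<^sup>1\<close> function \<open>p\<close>. Substituting
  \<open>f = p u\<close> into the two form inequalities turns them into
  \<open>\<bar>\<integral> V p\<^sup>2 u\<^sup>2\<bar> \<le> \<integral> p\<^sup>2 u'\<^sup>2\<close> for all compactly supported \<open>C\<^sup>1\<close> functions \<open>u\<close>.
  Divergence of the integrals of \<open>1 / p\<^sup>2\<close> provides cutoffs that are \<open>1\<close> on any given interval
  and have arbitrarily small right-hand side. By polarisation, \<open>\<integral> V p\<^sup>2 \<eta> = 0\<close> for every test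
  function \<open>\<eta>\<close>, whence \<open>V = 0\<close>.\<close>

section \<open>Smooth functions and bumps\<close>

text \<open>The constant 1 has energy 0 in the weighted Dirichlet form \<integral> p^2 u'^2, but no
  compact support. On an interval a function falling from 1 to 0 has energy at least 1 / \<integral>
  p^(-2) by Cauchy-Schwarz, with equality for u' proportional to p^(-2); so the two divergent
  integrals are what lets compactly supported u approach 1 with vanishing energy. A form bounded in
  absolute value by an energy that degenerates at 1 must have 1 in its kernel, and the absolute
  value is the reason for assuming both signs of V.

  Two obstacles account for most of the length. The hypotheses speak of smooth test functions,
  whereas \<open>p u\<close> and p u^2 are in general only C^1; so the form inequality and the weak
  equation are first extended by approximations that control function and derivative uniformly.
  Moreover, positivity of \<psi> passes to its continuous representative only as p \<ge> 0, and at a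
  zero p^(-2) would be singular; strict positivity comes from uniqueness for the Cauchy problem with
  a locally integrable coefficient.\<close>

primrec Ck :: "nat \<Rightarrow> (real \<Rightarrow> real) \<Rightarrow> bool" where
  "Ck 0 f \<longleftrightarrow> True"
| "Ck (Suc k) f \<longleftrightarrow> (\<exists>f'. (\<forall>x. (f has_real_derivative f' x) (at x)) \<and> Ck k f')"

text \<open>\<open>Ck k\<close> asks for k derivatives without continuity of the last one; over all
  k the difference from C^k disappears. Finite levels allow closure proofs by induction on k, where
  \<open>test_fun\<close> would require the whole sequence of derivatives at once.\<close>

definition smooth :: "(real \<Rightarrow> real) \<Rightarrow> bool" where
  "smooth f \<longleftrightarrow> (\<forall>k. Ck k f)"

lemma Ck_SucI: "(\<And>x. (f has_real_derivative f' x) (at x)) \<Longrightarrow> Ck k f' \<Longrightarrow> Ck (Suc k) f"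
  by auto

lemma Ck_Suc_imp: "Ck (Suc k) f \<Longrightarrow> Ck k f"
  by (induction k arbitrary: f) auto

lemma Ck_const: "Ck k (\<lambda>x. c)"
proof (induction k arbitrary: c)
  case (Suc k)
  show ?case by (rule Ck_SucI[OF _ Suc.IH[of 0]]) simp
qed simp

lemma Ck_add: "Ck k f \<Longrightarrow> Ck k g \<Longrightarrow> Ck k (\<lambda>x. f x + g x)"
proof (induction k arbitrary: f g)
  case (Suc k)
  then obtain f' g' where "\<And>x. (f has_real_derivative f' x) (at x)" "Ck k f'"
    "\<And>x. (g has_real_derivative g' x) (at x)" "Ck k g'"
    by auto
  then show ?case
    by (intro Ck_SucI[of _ "\<lambda>x. f' x + g' x"] Suc.IH DERIV_add)
qed simp

lemma Ck_mult: "Ck k f \<Longrightarrow> Ck k g \<Longrightarrow> Ck k (\<lambda>x. f x * g x)"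
proof (induction k arbitrary: f g)
  case (Suc k)
  then obtain f' g' where *: "\<And>x. (f has_real_derivative f' x) (at x)" "Ck k f'"
    "\<And>x. (g has_real_derivative g' x) (at x)" "Ck k g'"
    by auto
  have "Ck k (\<lambda>x. f' x * g x + g' x * f x)"
    using * Suc.prems[THEN Ck_Suc_imp] by (intro Ck_add Suc.IH)
  then show ?case
    using * by (intro Ck_SucI[of _ "\<lambda>x. f' x * g x + g' x * f x"] DERIV_mult)
qed simp

lemma Ck_affine: "Ck k f \<Longrightarrow> Ck k (\<lambda>x. f (a * x + b))"
proof (induction k arbitrary: f)
  case (Suc k)
  then obtain f' where *: "\<And>x. (f has_real_derivative f' x) (at x)" "Ck k f'"
    by auto
  have "((\<lambda>x. f (a * x + b)) has_real_derivative a * f' (a * x + b)) (at x)" for x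
    by (rule DERIV_chain2[OF *(1), THEN DERIV_cong]) (auto intro!: derivative_eq_intros)
  then show ?case
    using * by (intro Ck_SucI[of _ "\<lambda>x. a * f' (a * x + b)"] Ck_mult Ck_const Suc.IH)
qed simp

lemma smooth_const: "smooth (\<lambda>x. c)"
  and smooth_add: "smooth f \<Longrightarrow> smooth g \<Longrightarrow> smooth (\<lambda>x. f x + g x)"
  and smooth_mult: "smooth f \<Longrightarrow> smooth g \<Longrightarrow> smooth (\<lambda>x. f x * g x)"
  and smooth_affine: "smooth f \<Longrightarrow> smooth (\<lambda>x. f (a * x + b))"
  by (simp_all add: smooth_def Ck_const Ck_add Ck_mult Ck_affine)

lemma smooth_antiderivative:
  "(\<And>x. (f has_real_derivative f' x) (at x)) \<Longrightarrow> smooth f' \<Longrightarrow> smooth f"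
  unfolding smooth_def using Ck_Suc_imp[OF Ck_SucI] by blast

lemma smooth_derivative:
  assumes "smooth f"
  shows "smooth (deriv f)" "(f has_real_derivative deriv f x) (at x)"
proof -
  \<comment> \<open>The first derivative supplied by \<open>Ck (Suc k)\<close> could depend on k;
    uniqueness of derivatives identifies all these witnesses with \<open>deriv f\<close>.\<close>
  have *: "(\<forall>x. (f has_real_derivative deriv f x) (at x)) \<and> Ck k (deriv f)" for k
  proof -
    obtain f' where f': "\<And>x. (f has_real_derivative f' x) (at x)" "Ck k f'"
      using assms[unfolded smooth_def, rule_format, of "Suc k"] by auto
    then have "deriv f = f'"
      by (intro ext DERIV_imp_deriv)
    with f' show ?thesis by simp
  qed
  then show "smooth (deriv f)" "(f has_real_derivative deriv f x) (at x)"
    by (auto simp: smooth_def)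
qed

lemma test_fun_iff_smooth:
  fixes f :: "real \<Rightarrow> real"
  shows "test_fun f \<longleftrightarrow> smooth f \<and> bounded {x. f x \<noteq> 0}"
proof -
  have "smooth f" if D: "D 0 = f" "\<And>n x. (D n has_vector_derivative D (Suc n) x) (at x)" for D
  proof -
    have "Ck k (D n)" for k n
    proof (induction k arbitrary: n)
      case (Suc k)
      show ?case
        using D(2)[of n] by (intro Ck_SucI[OF _ Suc.IH[of "Suc n"]])
          (simp add: has_real_derivative_iff_has_vector_derivative)
    qed simp
    then show ?thesis using D(1) by (auto simp: smooth_def)
  qed
  moreover have "\<exists>D. D 0 = f \<and> (\<forall>n x. (D n has_vector_derivative D (Suc n) x) (at x))" if "smooth f"
  proof (intro exI conjI allI)
    have "smooth ((deriv ^^ n) f)" for n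
      by (induction n) (use that smooth_derivative in auto)
    from smooth_derivative(2)[OF this]
    show "((deriv ^^ n) f has_vector_derivative (deriv ^^ Suc n) f x) (at x)" for n x
      by (simp add: has_real_derivative_iff_has_vector_derivative)
  qed simp
  ultimately show ?thesis
    by (auto simp: test_fun_def)
qed

text \<open>The approximants below come from Stone-Weierstrass and are multiplied by a bump, so
  polynomials have to be smooth in the present sense.\<close>

lemma smooth_real_polynomial_function:
  fixes f :: "real \<Rightarrow> real"
  assumes "real_polynomial_function f"
  shows "smooth f"
  using assms
proof (induction rule: real_polynomial_function.induct)
  case (linear f)
  then obtain c where "f = (\<lambda>x. x * c)"
    using real_bounded_linear by blast
  moreover have "smooth (\<lambda>x. x * c)"
    by (rule smooth_antiderivative[OF _ smooth_const[of c]]) (auto intro!: derivative_eq_intros)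
  ultimately show ?case by simp
qed (auto intro: smooth_const smooth_add smooth_mult)

text \<open>The flat functions \<open>exp (- 1 / x) / x ^ n\<close> are closed under differentiation up to
  linear combinations.\<close>

lemma DERIV_flat:
  fixes n :: nat
  defines "f \<equiv> \<lambda>(n::nat) x::real. if x > 0 then exp (- 1 / x) / x ^ n else 0"
  shows "(f n has_real_derivative f (n + 2) x + - real n * f (n + 1) x) (at x)"
proof (cases x "0 :: real" rule: linorder_cases)
  case less
  have "((\<lambda>x. 0) has_real_derivative 0) (at x)" by simp
  then have "(f n has_real_derivative 0) (at x)"
    by (rule has_field_derivative_transform_within_open[of _ _ _ "{..<0}"]) (use less in \<open>auto simp: f_def\<close>)
  then show ?thesis using less by (simp add: f_def)
next
  case greater
  have "((\<lambda>x. exp (- 1 / x) / x ^ n) has_real_derivative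
      exp (- 1 / x) / x ^ (n + 2) + - real n * (exp (- 1 / x) / x ^ (n + 1))) (at x)"
    using greater
    by (auto intro!: derivative_eq_intros simp: field_simps power2_eq_square)
       (cases n; simp add: field_simps)
  then have "(f n has_real_derivative exp (- 1 / x) / x ^ (n + 2) + - real n * (exp (- 1 / x) / x ^ (n + 1))) (at x)"
    by (rule has_field_derivative_transform_within_open[of _ _ _ "{0<..}"]) (use greater in \<open>auto simp: f_def\<close>)
  then show ?thesis using greater by (simp add: f_def)
next
  case equal
  \<comment> \<open>With y = 1 / h the right difference quotient \<open>f n h / h\<close> at 0 is
    y^(n+1) / exp y; the left one vanishes identically.\<close>
  have "((\<lambda>y. y ^ (n + 1) / exp y) \<longlongrightarrow> (0::real)) at_top"
    by (rule tendsto_power_div_exp_0)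
  then have "((\<lambda>h. inverse h ^ (n + 1) / exp (inverse h)) \<longlongrightarrow> (0::real)) (at_right 0)"
    by (rule filterlim_compose[OF _ filterlim_inverse_at_top_right])
  then have "((\<lambda>h. f n h / h) \<longlongrightarrow> 0) (at_right 0)"
    by (rule Lim_transform_eventually)
      (auto simp: f_def eventually_at_filter exp_minus field_simps)
  moreover have "((\<lambda>h. f n h / h) \<longlongrightarrow> 0) (at_left 0)"
    by (rule tendsto_eventually) (auto simp: f_def eventually_at_filter)
  ultimately have "((\<lambda>h. f n h / h) \<longlongrightarrow> 0) (at 0)"
    by (simp add: filterlim_at_split)
  then show ?thesis using equal by (simp add: f_def DERIV_def cong: if_cong)
qed

lemma smooth_flat: "smooth (\<lambda>x. if x > 0 then exp (- 1 / x) else 0)"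
proof -
  have "Ck k (\<lambda>x::real. if x > 0 then exp (- 1 / x) / x ^ n else 0)" for k n
  proof (induction k arbitrary: n)
    case (Suc k)
    show ?case
      by (rule Ck_SucI[OF DERIV_flat]) (intro Ck_add Ck_mult Ck_const Suc.IH)
  qed simp
  from this[of _ 0] show ?thesis by (simp add: smooth_def cong: if_cong)
qed

text \<open>The product of a flat function starting at -R and a reflected one ending at R. The bound
  by 1 matters later: multiplication by the bump must not enlarge an approximation error.\<close>

lemma smooth_bump_exists:
  fixes R :: real
  assumes "R > 0"
  obtains \<beta> :: "real \<Rightarrow> real" where "smooth \<beta>" "\<And>x. \<bar>x\<bar> < R \<Longrightarrow> \<beta> x > 0" "\<And>x. \<bar>x\<bar> \<ge> R \<Longrightarrow> \<beta> x = 0"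
    "\<And>x. \<beta> x \<le> 1"
proof
  let ?f = "\<lambda>x::real. if x > 0 then exp (- 1 / x) else 0"
  let ?b = "\<lambda>x. ?f (1 * x + R) * ?f ((- 1) * x + R)"
  show "smooth ?b"
    by (intro smooth_mult smooth_affine smooth_flat)
qed (auto simp: zero_less_mult_iff intro!: mult_le_one)

section \<open>Compactly supported functions\<close>

text \<open>An explicit radius, rather than mere boundedness of the support, gives a whole sequence
  of functions one common interval, as dominated convergence requires. The endpoints are included,
  so antiderivatives can start from the value 0 at -R.\<close>

definition vanishes_beyond :: "real \<Rightarrow> (real \<Rightarrow> real) \<Rightarrow> bool" where
  "vanishes_beyond R f \<longleftrightarrow> (\<forall>x. R \<le> \<bar>x\<bar> \<longrightarrow> f x = 0)"

text \<open>The class in which the main argument runs: it is stable under multiplication by the C^1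
  function p, which smooth test functions are not. The derivative is a parameter because it is
  usually the object constructed first.\<close>

definition C1c :: "real \<Rightarrow> (real \<Rightarrow> real) \<Rightarrow> (real \<Rightarrow> real) \<Rightarrow> bool" where
  "C1c R f f' \<longleftrightarrow> (\<forall>x. (f has_real_derivative f' x) (at x)) \<and> continuous_on UNIV f' \<and>
     vanishes_beyond R f \<and> vanishes_beyond R f'"

lemma vanishes_beyond_mono: "vanishes_beyond r f \<Longrightarrow> r \<le> R \<Longrightarrow> vanishes_beyond R f"
  unfolding vanishes_beyond_def by (blast intro: order_trans)

lemma vanishes_beyond_mult:
  "vanishes_beyond R f \<Longrightarrow> vanishes_beyond R (\<lambda>x. f x * g x)"
  "vanishes_beyond R g \<Longrightarrow> vanishes_beyond R (\<lambda>x. f x * g x)"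
  by (simp_all add: vanishes_beyond_def)

lemma vanishes_beyond_indicator: "vanishes_beyond R h \<Longrightarrow> indicator {-R..R} x * h x = h x"
  by (cases "\<bar>x\<bar> \<le> R") (auto simp: vanishes_beyond_def abs_le_iff not_le indicator_def)

lemma vanishes_beyond_add:
  "vanishes_beyond R f \<Longrightarrow> vanishes_beyond R g \<Longrightarrow> vanishes_beyond R (\<lambda>x. f x + g x)"
  by (simp add: vanishes_beyond_def)

lemma vanishes_beyond_diff:
  "vanishes_beyond R f \<Longrightarrow> vanishes_beyond R g \<Longrightarrow> vanishes_beyond R (\<lambda>x. f x - g x)"
  by (simp add: vanishes_beyond_def)

lemma vanishes_beyond_continuous_bounded:
  assumes "continuous_on UNIV h" "vanishes_beyond R h"
  obtains M where "M \<ge> 0" "\<And>x. \<bar>h x\<bar> \<le> M"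
proof -
  have "compact (h ` {-\<bar>R\<bar>..\<bar>R\<bar>})"
    by (intro compact_continuous_image continuous_on_subset[OF assms(1)]) auto
  then obtain M where M: "\<forall>x\<in>{-\<bar>R\<bar>..\<bar>R\<bar>}. norm (h x) \<le> M"
    using bounded_iff compact_imp_bounded by (metis imageI)
  have "\<bar>h x\<bar> \<le> max M 0" for x
  proof (cases "\<bar>x\<bar> \<le> \<bar>R\<bar>")
    case True
    then show ?thesis using M[rule_format, of x] by (auto simp: abs_le_iff)
  next
    case False
    then show ?thesis using assms(2) by (auto simp: vanishes_beyond_def)
  qed
  then show ?thesis using that[of "max M 0"] by auto
qed

section \<open>Pairing locally integrable functions with bounded functions of compact
  support\<close>

lemma L1loc_mult_integrable:
  assumes "L1loc f" "h \<in> borel_measurable borel" "\<And>x. \<bar>h x\<bar> \<le> M" "vanishes_beyond R h"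
  shows "integrable lborel (\<lambda>x. f x * h x)"
proof -
  have f: "integrable lborel (\<lambda>x. indicator {-R..R} x * f x)"
    using assms(1) by (auto simp: L1loc_def set_integrable_def)
  have "integrable lborel (\<lambda>x. (indicator {-R..R} x * f x) * h x)"
  proof (rule Bochner_Integration.integrable_bound)
    show "integrable lborel (\<lambda>x. (indicator {-R..R} x * f x) * M)"
      using f by simp
    show "(\<lambda>x. indicator {-R..R} x * f x * h x) \<in> borel_measurable lborel"
      by (rule borel_measurable_times[OF borel_measurable_integrable[OF f]]) (simp add: assms(2))
    show "AE x in lborel. norm (indicator {-R..R} x * f x * h x) \<le> norm (indicator {-R..R} x * f x * M)"
      using assms(3) by (intro AE_I2) (auto simp: abs_mult intro!: mult_left_mono order.trans[OF _ abs_ge_self])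
  qed
  also have "(\<lambda>x. (indicator {-R..R} x * f x) * h x) = (\<lambda>x. f x * h x)"
    using vanishes_beyond_indicator[OF assms(4)] by (simp add: fun_eq_iff mult_ac)
  finally show ?thesis .
qed

lemma L1loc_mult_convergence:
  fixes h :: "real \<Rightarrow> real"
  assumes f: "L1loc f" and h: "\<And>k. hs k \<in> borel_measurable borel" "\<And>k x. \<bar>hs k x\<bar> \<le> M"
    "\<And>k. vanishes_beyond R (hs k)" "\<And>x. (\<lambda>k. hs k x) \<longlonglongrightarrow> h x"
  shows "(\<lambda>k. \<integral>x. f x * hs k x \<partial>lborel) \<longlonglongrightarrow> (\<integral>x. f x * h x \<partial>lborel)"
proof (rule integral_dominated_convergence)
  have hm: "h \<in> borel_measurable borel"
    using h(4,1) by (rule borel_measurable_LIMSEQ_real)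
  have hb: "\<bar>h x\<bar> \<le> M" for x
    using tendsto_rabs[OF h(4)] by (rule Lim_bounded) (use h(2) in auto)
  have hv: "vanishes_beyond R h"
    unfolding vanishes_beyond_def
  proof (intro allI impI)
    fix x assume "R \<le> \<bar>x\<bar>"
    then have "(\<lambda>k. hs k x) = (\<lambda>k. 0)" using h(3) by (auto simp: vanishes_beyond_def)
    then show "h x = 0" using h(4)[of x] by (simp add: LIMSEQ_const_iff)
  qed
  show "(\<lambda>x. f x * h x) \<in> borel_measurable lborel"
    using L1loc_mult_integrable[OF f hm hb hv] by auto
  show "(\<lambda>x. f x * hs k x) \<in> borel_measurable lborel" for k
    using L1loc_mult_integrable[OF f h(1,2,3)] by auto
  have "integrable lborel (\<lambda>x. \<bar>f x * (M * indicator {-R..R} x)\<bar>)"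
    using f by (simp add: L1loc_def set_integrable_def mult_ac)
  then show "integrable lborel (\<lambda>x. \<bar>f x * (M * indicator {-R..R} x)\<bar>)" .
  show "AE x in lborel. (\<lambda>k. f x * hs k x) \<longlonglongrightarrow> f x * h x"
    by (intro AE_I2 tendsto_mult tendsto_const h(4))
  have "norm (f x * hs k x) \<le> \<bar>f x * (M * indicator {-R..R} x)\<bar>" for k x
  proof (cases "\<bar>x\<bar> \<le> R")
    case True
    then have "\<bar>hs k x\<bar> \<le> \<bar>M\<bar>" using h(2)[of k x] by simp
    then show ?thesis using True by (auto simp: abs_mult indicator_def intro!: mult_left_mono)
  next
    case False
    then show ?thesis using h(3) by (auto simp: vanishes_beyond_def)
  qed
  then show "AE x in lborel. norm (f x * hs k x) \<le> \<bar>f x * (M * indicator {-R..R} x)\<bar>" for k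
    by auto
qed

lemma L1loc_mult_convergence_uniform:
  fixes h :: "real \<Rightarrow> real"
  assumes f: "L1loc f" and h: "continuous_on UNIV h" "vanishes_beyond R h"
    and hs: "\<And>k. continuous_on UNIV (hs k)" "\<And>k. vanishes_beyond R (hs k)"
    and conv: "\<And>k x. \<bar>hs k x - h x\<bar> \<le> inverse (Suc k)"
  shows "(\<lambda>k. \<integral>x. f x * hs k x \<partial>lborel) \<longlonglongrightarrow> (\<integral>x. f x * h x \<partial>lborel)"
proof -
  obtain M where M: "\<And>x. \<bar>h x\<bar> \<le> M"
    using vanishes_beyond_continuous_bounded[OF h] by blast
  show ?thesis
  proof (rule L1loc_mult_convergence[OF f _ _ hs(2), where M = "M + 1"])
    show "hs k \<in> borel_measurable borel" for k
      by (rule borel_measurable_continuous_onI[OF hs(1)])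
    show "\<bar>hs k x\<bar> \<le> M + 1" for k x
    proof -
      have "inverse (real (Suc k)) \<le> 1" by (simp add: field_simps)
      then show ?thesis using conv[of k x] M[of x] by linarith
    qed
    show "(\<lambda>k. hs k x) \<longlonglongrightarrow> h x" for x
    proof (rule LIM_zero_cancel, rule Lim_null_comparison[OF always_eventually LIMSEQ_inverse_real_of_nat])
      show "\<forall>k. norm (hs k x - h x) \<le> inverse (real (Suc k))"
        unfolding real_norm_def by (intro allI conv)
    qed
  qed
qed

lemma L1loc_1: "L1loc (\<lambda>x. 1)"
  by (simp add: L1loc_def set_integrable_def integrable_real_indicator emeasure_lborel_Icc_eq)

lemma continuous_integrable:
  assumes "continuous_on UNIV h" "vanishes_beyond R h"
  shows "integrable lborel h"
proof -
  obtain M where "\<And>x. \<bar>h x\<bar> \<le> M"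
    using vanishes_beyond_continuous_bounded[OF assms] by blast
  from L1loc_mult_integrable[OF L1loc_1 borel_measurable_continuous_onI[OF assms(1)] this assms(2)]
  show ?thesis by simp
qed

section \<open>Compactly supported functions and their antiderivatives\<close>

lemma integral_eq_antiderivative_diff:
  assumes "\<And>x. (F has_real_derivative h x) (at x)" "continuous_on UNIV h" "vanishes_beyond R h" "R \<ge> 0"
  shows "(\<integral>x. h x \<partial>lborel) = F R - F (-R)"
proof -
  have "(\<integral>x. indicator {-R..R} x *\<^sub>R h x \<partial>lborel) = F R - F (-R)"
    using assms(1,2,4) by (intro integral_FTC_atLeastAtMost)
      (auto simp: has_real_derivative_iff_has_vector_derivative[symmetric]
        intro: has_field_derivative_at_within continuous_on_subset)
  also have "(\<lambda>x. indicator {-R..R} x *\<^sub>R h x) = h"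
    using vanishes_beyond_indicator[OF assms(3)] by (simp add: fun_eq_iff)
  finally show ?thesis .
qed

lemma C1c_integral_deriv:
  assumes "C1c R f f'"
  shows "(\<integral>x. f' x \<partial>lborel) = 0"
  using integral_eq_antiderivative_diff[of f f' "\<bar>R\<bar>"] assms
  by (auto simp: C1c_def vanishes_beyond_def)

lemma antiderivative_exists:
  fixes h :: "real \<Rightarrow> real"
  assumes "continuous_on UNIV h"
  obtains F where "\<And>x. (F has_real_derivative h x) (at x)"
proof -
  have "isCont h x" for x
    using assms by (simp add: continuous_on_eq_continuous_at)
  then have "\<exists>F. \<forall>x :: real. -\<infinity> < ereal x \<longrightarrow> ereal x < \<infinity> \<longrightarrow> (F has_vector_derivative h x) (at x)"
    by (intro einterval_antiderivative) auto
  then show ?thesis using that by (auto simp: has_real_derivative_iff_has_vector_derivative)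
qed

lemma constant_on_ray:
  fixes F :: "real \<Rightarrow> real"
  assumes "\<And>x. (F has_real_derivative h x) (at x)" "\<And>x. x \<in> {a<..<b} \<Longrightarrow> h x = 0" "a \<le> b"
  shows "F a = F b"
proof (cases "a = b")
  case False
  have "continuous_on {a..b} F"
    by (rule DERIV_continuous_on[OF has_field_derivative_at_within[OF assms(1)]])
  moreover have "(F has_real_derivative 0) (at x)" if "a < x" "x < b" for x
    using assms(1)[of x] assms(2)[of x] that by simp
  ultimately have "F b = F a"
    using False assms(3) by (intro DERIV_isconst_end) auto
  then show ?thesis by simp
qed simp

text \<open>Zero mean is exactly what makes the antiderivative normalised at R vanish at -R too; on
  both outer rays it is constant because h is 0 there.\<close>

lemma C1c_antiderivative:
  assumes h: "continuous_on UNIV h" "vanishes_beyond R h" "(\<integral>x. h x \<partial>lborel) = 0" and R: "R \<ge> 0"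
  obtains F where "C1c R F h"
proof -
  obtain F where F: "\<And>x. (F has_real_derivative h x) (at x)"
    using antiderivative_exists[OF h(1)] by blast
  define G where "G x = F x - F R" for x
  have G: "(G has_real_derivative h x) (at x)" for x
    unfolding G_def by (auto intro!: derivative_eq_intros F)
  have eq: "F R = F (-R)"
    using integral_eq_antiderivative_diff[OF F h(1,2) R] h(3) by simp
  have "G x = 0" if "R \<le> \<bar>x\<bar>" for x
  proof (cases "x \<ge> 0")
    case True
    then have "G R = G x"
      using h(2) that R by (intro constant_on_ray[OF G]) (auto simp: vanishes_beyond_def)
    then show ?thesis by (simp add: G_def)
  next
    case False
    then have "G x = G (-R)"
      using h(2) that R by (intro constant_on_ray[OF G]) (auto simp: vanishes_beyond_def)
    then show ?thesis by (simp add: G_def eq)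
  qed
  then have "C1c R G h"
    using G h by (auto simp: C1c_def vanishes_beyond_def)
  then show ?thesis by (rule that)
qed

lemma C1c_bound:
  assumes "C1c R f f'" "\<And>x. \<bar>f' x\<bar> \<le> B" "R \<ge> 0"
  shows "\<bar>f x\<bar> \<le> 2 * R * B"
proof (cases "\<bar>x\<bar> < R")
  case True
  have f: "\<And>x. (f has_real_derivative f' x) (at x)" and v: "f (-R) = 0"
    using assms(1,3) by (auto simp: C1c_def vanishes_beyond_def)
  obtain z where z: "f x - f (-R) = (x - (-R)) * f' z"
    using MVT2[of "-R" x f f'] f True by (auto simp: abs_less_iff)
  then have "\<bar>f x\<bar> = \<bar>x + R\<bar> * \<bar>f' z\<bar>" using v by (simp add: abs_mult)
  also have "\<dots> \<le> (2 * R) * B"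
    using True assms(2)[of z] by (intro mult_mono) auto
  finally show ?thesis .
next
  case False
  moreover have "B \<ge> 0" using assms(2)[of 0] by linarith
  ultimately show ?thesis using assms(1,3) by (auto simp: C1c_def vanishes_beyond_def)
qed

lemma C1c_continuous: "C1c R f f' \<Longrightarrow> continuous_on UNIV f"
  unfolding C1c_def by (meson DERIV_continuous_on has_field_derivative_at_within)

lemma smooth_continuous: "smooth f \<Longrightarrow> continuous_on UNIV f"
  by (meson DERIV_continuous_on has_field_derivative_at_within smooth_derivative(2))

lemma smooth_C1c:
  assumes "smooth f" "vanishes_beyond R f"
  shows "C1c R f (deriv f)"
proof -
  have cont: "continuous_on UNIV (deriv f)"
    by (rule smooth_continuous[OF smooth_derivative(1)[OF assms(1)]])
  have "deriv f x = 0" if "\<bar>x\<bar> > R" for x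
  proof -
    have "open {x::real. \<bar>x\<bar> > R}"
      by (intro open_Collect_less continuous_intros)
    then have "(f has_real_derivative 0) (at x)"
      by (rule has_field_derivative_transform_within_open[OF DERIV_const[of 0]])
        (use that assms(2) in \<open>auto simp: vanishes_beyond_def\<close>)
    then show ?thesis by (rule DERIV_imp_deriv)
  qed
  note outside = this
  have "vanishes_beyond R (deriv f)"
    unfolding vanishes_beyond_def
  proof (intro allI impI)
    fix x assume x: "R \<le> \<bar>x\<bar>"
    have "deriv f x = 0" if R: "\<bar>x\<bar> = R"
    proof -
      \<comment> \<open>At an endpoint f need not be locally constant. The sign s points outward,
        and continuity of \<open>deriv f\<close> carries the value 0 in from outside.\<close>
      define s where "s = (if x \<ge> 0 then 1 else -1 :: real)"
      have "(\<lambda>n. deriv f (x + s * inverse (real (Suc n)))) \<longlonglongrightarrow> deriv f (x + s * 0)"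
        using cont by (intro isCont_tendsto_compose[of _ "deriv f"] tendsto_intros LIMSEQ_inverse_real_of_nat)
          (auto simp: continuous_on_eq_continuous_at)
      moreover have "deriv f (x + s * inverse (real (Suc n))) = 0" for n
      proof (rule outside)
        have "inverse (real (Suc n)) > 0" by simp
        then show "\<bar>x + s * inverse (real (Suc n))\<bar> > R"
          using R unfolding s_def by (auto simp del: inverse_positive_iff_positive of_nat_Suc)
      qed
      ultimately show ?thesis by (simp add: LIMSEQ_const_iff)
    qed
    then show "deriv f x = 0" using x outside[of x] by fastforce
  qed
  then show ?thesis
    using assms smooth_derivative(2) cont by (auto simp: C1c_def)
qed

lemma test_fun_iff_vanishes:
  fixes f :: "real \<Rightarrow> real"
  shows "test_fun f \<longleftrightarrow> smooth f \<and> (\<exists>R>0. vanishes_beyond R f)"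
proof -
  have "(\<exists>R>0. vanishes_beyond R f) \<longleftrightarrow> bounded {x. f x \<noteq> 0}"
  proof
    assume "\<exists>R>0. vanishes_beyond R f"
    then obtain R where "vanishes_beyond R f" by blast
    then have "\<forall>x\<in>{x. f x \<noteq> 0}. \<bar>x\<bar> \<le> R"
      by (metis (mono_tags) linorder_linear mem_Collect_eq vanishes_beyond_def)
    then show "bounded {x. f x \<noteq> 0}"
      unfolding bounded_real by blast
  next
    assume "bounded {x. f x \<noteq> 0}"
    then obtain B where "B > 0" "\<forall>x\<in>{x. f x \<noteq> 0}. norm x \<le> B"
      by (auto simp: bounded_pos)
    then show "\<exists>R>0. vanishes_beyond R f"
      by (intro exI[of _ "B + 1"]) (force simp: vanishes_beyond_def)
  qed
  then show ?thesis by (simp add: test_fun_iff_smooth)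
qed

text \<open>Divide h by a bump, approximate the quotient by a polynomial, multiply back: the product
  is smooth with compact support, and the bump, being at most 1, does not increase the error. The
  gap between r and R keeps the quotient continuous, since h vanishes before the bump does.\<close>

lemma smooth_uniform_approx:
  assumes h: "continuous_on UNIV h" "vanishes_beyond r h" and r: "0 < r" "r < R" and e: "e > 0"
  obtains \<eta> where "smooth \<eta>" "vanishes_beyond R \<eta>" "\<And>x. \<bar>\<eta> x - h x\<bar> < e"
proof -
  obtain \<beta> where \<beta>: "smooth \<beta>" "\<And>x. \<bar>x\<bar> < R \<Longrightarrow> \<beta> x > 0" "\<And>x. \<bar>x\<bar> \<ge> R \<Longrightarrow> \<beta> x = 0" "\<And>x. \<beta> x \<le> 1"
    by (rule smooth_bump_exists[OF order.strict_trans[OF r]]) blast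
  have \<beta>_nz: "\<beta> x \<noteq> 0" if "x \<in> {-R<..<R}" for x
  proof -
    have "\<bar>x\<bar> < R" using that by auto
    from \<beta>(2)[OF this] show ?thesis by simp
  qed
  have h_zero: "h x / \<beta> x = 0" if "x \<in> {x. r < \<bar>x\<bar>}" for x
    using h(2) that by (simp add: vanishes_beyond_def)
  \<comment> \<open>Two open sets cover the line: on one the bump is nonzero, on the other the
    numerator is 0, so the quotient is 0 there even where the bump vanishes.\<close>
  have "continuous_on ({-R<..<R} \<union> {x. r < \<bar>x\<bar>}) (\<lambda>x. h x / \<beta> x)"
  proof (rule continuous_on_open_Un)
    show "open {x::real. r < \<bar>x\<bar>}"
      by (intro open_Collect_less continuous_intros)
    show "continuous_on {-R<..<R} (\<lambda>x. h x / \<beta> x)"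
      by (intro continuous_on_divide continuous_on_subset[OF h(1)]
          continuous_on_subset[OF smooth_continuous[OF \<beta>(1)]] ballI \<beta>_nz) auto
    show "continuous_on {x. r < \<bar>x\<bar>} (\<lambda>x. h x / \<beta> x)"
      by (subst continuous_on_cong[OF refl h_zero]) auto
  qed auto
  also have "{-R<..<R} \<union> {x. r < \<bar>x\<bar>} = UNIV" using r by auto
  finally have "continuous_on {-R..R} (\<lambda>x. h x / \<beta> x)"
    by (rule continuous_on_subset) auto
  from Stone_Weierstrass_real_polynomial_function[OF compact_Icc this e]
  obtain p where p: "real_polynomial_function p" "\<And>x. x \<in> {-R..R} \<Longrightarrow> \<bar>h x / \<beta> x - p x\<bar> < e"
    by blast
  show ?thesis
  proof (rule that)
    show "smooth (\<lambda>x. \<beta> x * p x)"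
      by (rule smooth_mult[OF \<beta>(1) smooth_real_polynomial_function[OF p(1)]])
    show "vanishes_beyond R (\<lambda>x. \<beta> x * p x)"
      by (simp add: vanishes_beyond_def \<beta>(3))
    show "\<bar>\<beta> x * p x - h x\<bar> < e" for x
    proof (cases "\<bar>x\<bar> < R")
      case True
      then have "\<bar>\<beta> x * p x - h x\<bar> = \<beta> x * \<bar>h x / \<beta> x - p x\<bar>"
        using \<beta>(2)[OF True] abs_mult_pos'[of "\<beta> x" "h x / \<beta> x - p x"]
        by (simp add: right_diff_distrib abs_minus_commute)
      also have "\<dots> \<le> \<bar>h x / \<beta> x - p x\<bar>"
        using \<beta>(4)[of x] \<beta>(2)[OF True] by (intro mult_left_le_one_le) auto
      also have "\<dots> < e" using True by (intro p(2)) (auto simp: abs_less_iff)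
      finally show ?thesis .
    next
      case False
      then show ?thesis using \<beta>(3)[of x] vanishes_beyond_mono[OF h(2) less_imp_le[OF r(2)]] e
        by (simp add: vanishes_beyond_def)
    qed
  qed
qed

section \<open>Test functions\<close>

lemma L1loc_continuous_mult_integrable:
  assumes "L1loc f" "continuous_on UNIV h" "vanishes_beyond R h"
  shows "integrable lborel (\<lambda>x. f x * h x)"
proof -
  obtain M where "\<And>x. \<bar>h x\<bar> \<le> M"
    using vanishes_beyond_continuous_bounded[OF assms(2,3)] by blast
  from L1loc_mult_integrable[OF assms(1) borel_measurable_continuous_onI[OF assms(2)] this assms(3)]
  show ?thesis .
qed

lemma L1loc_continuous: "continuous_on UNIV f \<Longrightarrow> L1loc f"
  unfolding L1loc_def by (meson borel_integrable_atLeastAtMost' continuous_on_subset subset_UNIV)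

lemma L1loc_add: "L1loc f \<Longrightarrow> L1loc g \<Longrightarrow> L1loc (\<lambda>x. f x + g x)"
  by (simp add: L1loc_def)

lemma L1loc_diff: "L1loc f \<Longrightarrow> L1loc g \<Longrightarrow> L1loc (\<lambda>x. f x - g x)"
  by (simp add: L1loc_def)

lemma L1loc_cmult: "L1loc f \<Longrightarrow> L1loc (\<lambda>x. c * f x)"
  by (simp add: L1loc_def)

lemma bump_integral_pos:
  assumes R: "R > 0" and \<beta>: "continuous_on UNIV \<beta>" "\<And>x. \<bar>x\<bar> < R \<Longrightarrow> \<beta> x > 0" "vanishes_beyond R \<beta>"
  shows "(\<integral>x. \<beta> x \<partial>lborel) > 0"
proof -
  have nonneg: "\<beta> x \<ge> 0" for x
    using \<beta>(2)[of x] \<beta>(3) by (cases "\<bar>x\<bar> < R") (auto simp: vanishes_beyond_def)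
  have int: "integrable lborel \<beta>" by (rule continuous_integrable[OF \<beta>(1,3)])
  have "(\<integral>x. \<beta> x \<partial>lborel) \<noteq> 0"
  proof
    assume "(\<integral>x. \<beta> x \<partial>lborel) = 0"
    then have "AE x in lborel. \<beta> x = 0"
      using integral_nonneg_eq_0_iff_AE[OF int] nonneg by simp
    moreover have "AE x in lborel. x \<in> {-R<..<R} \<longrightarrow> \<beta> x \<noteq> 0"
      using \<beta>(2) by (intro AE_I2 impI) (metis abs_less_iff greaterThanLessThan_iff less_irrefl minus_less_iff)
    ultimately have "AE x in lborel. x \<notin> {-R<..<R}"
      by eventually_elim auto
    then have "emeasure lborel {-R<..<R} = 0"
      by (subst (asm) AE_iff_measurable[of "{-R<..<R}"]) auto
    then show False using R by simp
  qed
  moreover have "(\<integral>x. \<beta> x \<partial>lborel) \<ge> 0" using nonneg by simp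
  ultimately show ?thesis by simp
qed

section \<open>Approximation by smooth functions together with the first derivative\<close>

lemma normalized_bump_exists:
  assumes "R > 0"
  obtains \<beta> :: "real \<Rightarrow> real" where "smooth \<beta>" "vanishes_beyond R \<beta>" "(\<integral>x. \<beta> x \<partial>lborel) = 1"
proof -
  obtain b :: "real \<Rightarrow> real" where b: "smooth b" "\<And>x. \<bar>x\<bar> < R \<Longrightarrow> b x > 0" "\<And>x. \<bar>x\<bar> \<ge> R \<Longrightarrow> b x = 0"
    by (rule smooth_bump_exists[OF assms]) blast
  have v: "vanishes_beyond R b" by (simp add: vanishes_beyond_def b(3))
  have pos: "(\<integral>x. b x \<partial>lborel) > 0"
    by (rule bump_integral_pos[OF assms smooth_continuous[OF b(1)] b(2) v])
  show ?thesis
  proof (rule that)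
    show "smooth (\<lambda>x. (1 / (\<integral>x. b x \<partial>lborel)) * b x)"
      by (rule smooth_mult[OF smooth_const b(1)])
    show "vanishes_beyond R (\<lambda>x. (1 / (\<integral>x. b x \<partial>lborel)) * b x)"
      by (rule vanishes_beyond_mult(2)[OF v])
    show "(\<integral>x. (1 / (\<integral>x. b x \<partial>lborel)) * b x \<partial>lborel) = 1"
      using pos by simp
  qed
qed

lemma integral_abs_le_of_bound:
  assumes "integrable lborel h" "vanishes_beyond R h" "\<And>x. \<bar>h x\<bar> \<le> B" "R \<ge> 0"
  shows "\<bar>\<integral>x. h x \<partial>lborel\<bar> \<le> 2 * R * B"
proof -
  have "\<bar>\<integral>x. h x \<partial>lborel\<bar> \<le> (\<integral>x. \<bar>h x\<bar> \<partial>lborel)"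
    by simp
  also have "\<dots> \<le> (\<integral>x. indicator {-R..R} x * B \<partial>lborel)"
  proof (rule integral_mono)
    show "integrable lborel (\<lambda>x. indicator {-R..R} x * B)"
      by (simp add: integrable_real_indicator emeasure_lborel_Icc_eq)
    show "\<bar>h x\<bar> \<le> indicator {-R..R} x * B" for x
      using assms(3)[of x] vanishes_beyond_indicator[OF assms(2), of x]
      by (cases "x \<in> {-R..R}") (auto simp: indicator_def)
  qed (use assms in auto)
  also have "\<dots> = 2 * R * B" using assms(4) by simp
  finally show ?thesis .
qed

text \<open>Approximate f' and integrate. The approximant \<theta> of f' may have nonzero mean c, so
  its antiderivative need not return to 0; subtracting c times a bump of unit mass repairs this.
  Since f' has mean 0, c is as small as the error of \<theta>.\<close>

lemma C1c_approx:
  assumes f: "C1c r f f'" and r: "0 < r" "r < R" and e: "e > 0"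
  obtains \<eta> where "smooth \<eta>" "vanishes_beyond R \<eta>"
    "\<And>x. \<bar>\<eta> x - f x\<bar> \<le> e" "\<And>x. \<bar>deriv \<eta> x - f' x\<bar> \<le> e"
proof -
  have R: "R > 0" using r by simp
  have f'c: "continuous_on UNIV f'" and f'v: "vanishes_beyond r f'" and f'vR: "vanishes_beyond R f'"
    and fvR: "vanishes_beyond R f"
    using f vanishes_beyond_mono[OF _ less_imp_le[OF r(2)]] by (auto simp: C1c_def)
  obtain \<beta> where \<beta>: "smooth \<beta>" "vanishes_beyond R \<beta>" "(\<integral>x. \<beta> x \<partial>lborel) = 1"
    by (rule normalized_bump_exists[OF R])
  obtain M where M: "M \<ge> 0" "\<And>x. \<bar>\<beta> x\<bar> \<le> M"
    using vanishes_beyond_continuous_bounded[OF smooth_continuous[OF \<beta>(1)] \<beta>(2)] by blast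
  \<comment> \<open>The factor 1 + 2 R M pays for the mean correction, and 1 + 2 R pays for passing
    from derivatives to functions by \<open>C1c_bound\<close> while also being at least 1, so that
    both errors stay below e.\<close>
  define d where "d = e / ((1 + 2 * R * M) * (1 + 2 * R))"
  have pos: "1 + 2 * R * M > 0" "1 + 2 * R > 0" using R M by (auto intro: add_pos_nonneg)
  have d: "d > 0" using e pos by (simp add: d_def)
  obtain \<theta> where \<theta>: "smooth \<theta>" "vanishes_beyond R \<theta>" "\<And>x. \<bar>\<theta> x - f' x\<bar> < d"
    using smooth_uniform_approx[OF f'c f'v r d] by blast
  have int: "integrable lborel \<theta>" "integrable lborel f'" "integrable lborel \<beta>"
    using continuous_integrable[OF smooth_continuous[OF \<theta>(1)] \<theta>(2)] continuous_integrable[OF f'c f'v]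
      continuous_integrable[OF smooth_continuous[OF \<beta>(1)] \<beta>(2)] by auto
  define c where "c = (\<integral>x. \<theta> x \<partial>lborel)"
  have c: "\<bar>c\<bar> \<le> 2 * R * d"
  proof -
    have "c = (\<integral>x. \<theta> x - f' x \<partial>lborel)"
      using int C1c_integral_deriv[OF f] by (simp add: c_def)
    then show ?thesis
      using integral_abs_le_of_bound[of "\<lambda>x. \<theta> x - f' x" R d] int \<theta> f'vR R
      by (auto intro: vanishes_beyond_diff less_imp_le)
  qed
  define g where "g = (\<lambda>x. \<theta> x + (- c) * \<beta> x)"
  have g: "smooth g" "vanishes_beyond R g"
    unfolding g_def by (intro smooth_add smooth_mult smooth_const \<theta>(1) \<beta>(1),
        intro vanishes_beyond_add vanishes_beyond_mult(2) \<theta>(2) \<beta>(2))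
  have "(\<integral>x. g x \<partial>lborel) = 0"
    using int \<beta>(3) by (simp add: g_def c_def)
  then obtain \<eta> where \<eta>: "C1c R \<eta> g"
    using C1c_antiderivative[OF smooth_continuous[OF g(1)] g(2)] R by auto
  have deriv: "deriv \<eta> = g"
    using \<eta> by (auto simp: C1c_def intro!: DERIV_imp_deriv)
  have g_bound: "\<bar>g x - f' x\<bar> \<le> (1 + 2 * R * M) * d" for x
  proof -
    have "\<bar>g x - f' x\<bar> \<le> \<bar>\<theta> x - f' x\<bar> + \<bar>c\<bar> * \<bar>\<beta> x\<bar>"
      unfolding g_def abs_mult[symmetric] by linarith
    also have "\<dots> \<le> d + (2 * R * d) * M"
      using c M less_imp_le[OF \<theta>(3)[of x]] R d by (intro add_mono mult_mono) auto
    finally show ?thesis by (simp add: algebra_simps)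
  qed
  have le1: "(1 + 2 * R * M) * d * (1 + 2 * R) = e" using pos by (simp add: d_def)
  have "C1c R (\<lambda>x. \<eta> x - f x) (\<lambda>x. g x - f' x)"
    using \<eta> f fvR f'vR by (auto simp: C1c_def intro!: DERIV_diff continuous_on_diff vanishes_beyond_diff)
  note \<eta>_bound = C1c_bound[OF this g_bound]
  show ?thesis
  proof (rule that)
    show "smooth \<eta>"
      using \<eta> by (intro smooth_antiderivative[OF _ g(1)]) (auto simp: C1c_def)
    show "vanishes_beyond R \<eta>" using \<eta> by (simp add: C1c_def)
    have K: "0 \<le> (1 + 2 * R * M) * d" using pos d by simp
    show "\<bar>\<eta> x - f x\<bar> \<le> e" for x
      using \<eta>_bound[of x] R K le1 by (simp add: algebra_simps)
    show "\<bar>deriv \<eta> x - f' x\<bar> \<le> e" for x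
      using g_bound[of x] mult_left_mono[of 1 "1 + 2 * R" "(1 + 2 * R * M) * d"] R K le1
      unfolding deriv by linarith
  qed
qed

lemma C1c_approx_sequence:
  assumes "C1c r f f'" "0 < r" "r < R"
  obtains \<eta> where "\<And>k. smooth (\<eta> k)" "\<And>k. vanishes_beyond R (\<eta> k)"
    "\<And>k x. \<bar>\<eta> k x - f x\<bar> \<le> inverse (real (Suc k))"
    "\<And>k x. \<bar>deriv (\<eta> k) x - f' x\<bar> \<le> inverse (real (Suc k))"
proof -
  have "\<exists>\<eta>. smooth \<eta> \<and> vanishes_beyond R \<eta> \<and> (\<forall>x. \<bar>\<eta> x - f x\<bar> \<le> inverse (real (Suc k))) \<and>
      (\<forall>x. \<bar>deriv \<eta> x - f' x\<bar> \<le> inverse (real (Suc k)))" for k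
    by (rule C1c_approx[OF assms, of "inverse (real (Suc k))"]) (simp, blast)
  then show ?thesis using that by metis
qed

section \<open>Operations on test functions\<close>

lemma test_funI: "smooth f \<Longrightarrow> vanishes_beyond R f \<Longrightarrow> test_fun (f :: real \<Rightarrow> real)"
  unfolding test_fun_iff_vanishes
  by (meson gt_ex less_imp_le max.cobounded1 max_less_iff_conj vanishes_beyond_mono zero_less_one order.strict_trans2)

lemma test_funE:
  assumes "test_fun (f :: real \<Rightarrow> real)"
  obtains R where "R > 0" "smooth f" "vanishes_beyond R f"
  using assms unfolding test_fun_iff_vanishes by blast

lemma test_fun_lincomb:
  fixes f g :: "real \<Rightarrow> real"
  assumes "test_fun f" "test_fun g"
  shows "test_fun (\<lambda>x. a * f x + b * g x)"
proof -
  obtain R where f: "smooth f" "vanishes_beyond R f" using assms(1) by (rule test_funE)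
  obtain S where g: "smooth g" "vanishes_beyond S g" using assms(2) by (rule test_funE)
  show ?thesis
    by (rule test_funI[of _ "max R S"])
      (intro smooth_add smooth_mult smooth_const f g,
       intro vanishes_beyond_add vanishes_beyond_mult(2) vanishes_beyond_mono[OF f(2)] vanishes_beyond_mono[OF g(2)], auto)
qed

lemma test_fun_deriv:
  fixes f :: "real \<Rightarrow> real"
  assumes "test_fun f"
  shows "test_fun (deriv f)"
proof -
  obtain R where f: "smooth f" "vanishes_beyond R f" using assms by (rule test_funE)
  show ?thesis
    using smooth_C1c[OF f] smooth_derivative(1)[OF f(1)] by (auto simp: C1c_def intro: test_funI)
qed

lemma test_fun_integrable:
  fixes \<eta> :: "real \<Rightarrow> real"
  assumes "L1loc f" "test_fun \<eta>"
  shows "integrable lborel (\<lambda>x. f x * \<eta> x)"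
proof -
  obtain R where "smooth \<eta>" "vanishes_beyond R \<eta>" using assms(2) by (rule test_funE)
  then show ?thesis
    by (intro L1loc_continuous_mult_integrable[OF assms(1) smooth_continuous])
qed

section \<open>Locally integrable functions that vanish as distributions\<close>

lemma integral_all_Icc_zero_imp_AE_zero:
  fixes f :: "real \<Rightarrow> real"
  assumes f: "L1loc f" and zero: "\<And>a b. a \<le> b \<Longrightarrow> (\<integral>x. f x * indicator {a..b} x \<partial>lborel) = 0"
  shows "AE x in lborel. f x = 0"
proof -
  have "AE x in lborel. f x * indicator {- real n..real n} x = 0" for n
  proof -
    define F where "F = (\<lambda>x. f x * indicator {- real n..real n} x)"
    have F: "integrable lborel F"
      using f by (simp add: L1loc_def set_integrable_def F_def mult.commute)
    then have Fm[measurable]: "F \<in> borel_measurable borel" by auto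
    have FI: "integrable lborel (\<lambda>y. F y * indicator {x<..} y)" for x
      using F by (rule integrable_real_mult_indicator[rotated]) auto
    have F0: "(\<integral>y. F y * indicator {x<..} y \<partial>lborel) = 0" for x
    proof -
      let ?a = "max x (- real n)"
      have "(\<integral>y. F y * indicator {x<..} y \<partial>lborel) = (\<integral>y. f y * indicator {?a..real n} y \<partial>lborel)"
      proof (rule integral_cong_AE)
        show "(\<lambda>y. F y * indicator {x<..} y) \<in> borel_measurable lborel" by measurable
        have "set_integrable lborel {?a..real n} f"
          using f by (simp add: L1loc_def)
        then show "(\<lambda>y. f y * indicator {?a..real n} y) \<in> borel_measurable lborel"
          unfolding set_integrable_def by (auto simp: mult.commute dest: borel_measurable_integrable)
        show "AE y in lborel. F y * indicator {x<..} y = f y * indicator {?a..real n} y"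
          using AE_lborel_singleton[of x]
          by eventually_elim (auto simp: F_def indicator_def)
      qed
      also have "\<dots> = 0"
        by (cases "?a \<le> real n") (use zero[of ?a "real n"] in auto)
      finally show ?thesis .
    qed
    \<comment> \<open>Since \<open>ennreal\<close> sends negative reals to 0, these are the positive
      and negative parts of F. As densities they give finite measures agreeing on all rays
      \<open>{x<..}\<close>; hence the measures coincide, and the densities agree almost everywhere,
      which forces F = 0.\<close>
    let ?p = "\<lambda>x. ennreal (F x)" and ?q = "\<lambda>x. ennreal (- F x)"
    have fin: "(\<integral>\<^sup>+ y. ennreal \<bar>F y\<bar> \<partial>lborel) < \<infinity>"
      using F by (simp add: integrable_iff_bounded)
    have "density lborel ?p = density lborel ?q"
    proof (rule measure_eqI_lessThan)
      show "emeasure (density lborel ?p) {x<..} < \<infinity>" for x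
      proof -
        have "emeasure (density lborel ?p) {x<..} \<le> (\<integral>\<^sup>+ y. ennreal \<bar>F y\<bar> \<partial>lborel)"
          by (subst emeasure_density)
            (auto intro!: nn_integral_mono ennreal_leI split: split_indicator)
        then show ?thesis using fin by (rule order.strict_trans1)
      qed
      show "emeasure (density lborel ?p) {x<..} = emeasure (density lborel ?q) {x<..}" for x
      proof -
        have "(\<integral>\<^sup>+ y. ennreal (F y) * indicator {x<..} y \<partial>lborel) =
            (\<integral>\<^sup>+ y. ennreal (F y * indicator {x<..} y) \<partial>lborel)"
          by (intro nn_integral_cong) (auto split: split_indicator)
        moreover have "(\<integral>\<^sup>+ y. ennreal (- F y) * indicator {x<..} y \<partial>lborel) =
            (\<integral>\<^sup>+ y. ennreal (- (F y * indicator {x<..} y)) \<partial>lborel)"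
          by (intro nn_integral_cong) (auto split: split_indicator)
        moreover have fin2: "(\<integral>\<^sup>+ y. ennreal (F y * indicator {x<..} y) \<partial>lborel) < \<infinity>"
          "(\<integral>\<^sup>+ y. ennreal (- (F y * indicator {x<..} y)) \<partial>lborel) < \<infinity>"
          using FI[of x] by (auto simp: real_integrable_def less_top)
        moreover have "enn2real (\<integral>\<^sup>+ y. ennreal (F y * indicator {x<..} y) \<partial>lborel) =
            enn2real (\<integral>\<^sup>+ y. ennreal (- (F y * indicator {x<..} y)) \<partial>lborel)"
          using F0[of x] real_lebesgue_integral_def[OF FI[of x]] by simp
        ultimately show ?thesis
          by (simp add: emeasure_density) (metis ennreal_enn2real infinity_ennreal_def)
      qed
    qed auto
    then have "AE x in lborel. ?p x = ?q x"
      by (subst (asm) sigma_finite_measure.density_unique_iff[OF sigma_finite_lborel]) auto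
    then show ?thesis
    proof eventually_elim
      fix x assume "?p x = ?q x"
      then have "F x = 0"
        by (cases "F x \<ge> 0") (auto simp: ennreal_neg ennreal_eq_0_iff)
      then show "f x * indicator {- real n..real n} x = 0" by (simp add: F_def)
    qed
  qed
  then have "AE x in lborel. \<forall>n. f x * indicator {- real n..real n} x = 0"
    unfolding AE_all_countable by blast
  then show ?thesis
  proof eventually_elim
    fix x assume *: "\<forall>n. f x * indicator {- real n..real n} x = 0"
    obtain n where "\<bar>x\<bar> \<le> real n" using real_arch_simple by blast
    then have "x \<in> {- real n..real n}" by auto
    then show "f x = 0" using *[rule_format, of n] by simp
  qed
qed

text \<open>The class of factors is enlarged twice: from smooth to continuous ones by uniform
  approximation, then to indicators of intervals by bounded pointwise limits.\<close>

lemma L1loc_test_zero_imp_AE_zero: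
  fixes f :: "real \<Rightarrow> real"
  assumes f: "L1loc f" and zero: "\<And>\<eta>. test_fun \<eta> \<Longrightarrow> (\<integral>x. f x * \<eta> x \<partial>lborel) = 0"
  shows "AE x in lborel. f x = 0"
proof (rule integral_all_Icc_zero_imp_AE_zero[OF f])
  have cont: "(\<integral>x. f x * h x \<partial>lborel) = 0"
    if h: "continuous_on UNIV h" "vanishes_beyond r h" and r: "r > 0" for h r
  proof -
    have "\<exists>\<eta>. smooth \<eta> \<and> vanishes_beyond (r + 1) \<eta> \<and> (\<forall>x. \<bar>\<eta> x - h x\<bar> \<le> inverse (real (Suc k)))" for k
    proof -
      have "inverse (real (Suc k)) > 0" by simp
      from smooth_uniform_approx[OF h r _ this, of "r + 1"] show ?thesis
        by (smt (verit, best))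
    qed
    then obtain \<eta> where \<eta>: "\<And>k. smooth (\<eta> k)" "\<And>k. vanishes_beyond (r + 1) (\<eta> k)"
      "\<And>k x. \<bar>\<eta> k x - h x\<bar> \<le> inverse (real (Suc k))"
      by metis
    have "(\<lambda>k. \<integral>x. f x * \<eta> k x \<partial>lborel) \<longlonglongrightarrow> (\<integral>x. f x * h x \<partial>lborel)"
      by (rule L1loc_mult_convergence_uniform[OF f h(1) vanishes_beyond_mono[OF h(2), of "r + 1"]
            smooth_continuous[OF \<eta>(1)] \<eta>(2) \<eta>(3)]) simp
    moreover have "(\<integral>x. f x * \<eta> k x \<partial>lborel) = 0" for k
      by (rule zero[OF test_funI[OF \<eta>(1,2)]])
    ultimately show ?thesis by (simp add: LIMSEQ_const_iff)
  qed
  fix a b :: real assume ab: "a \<le> b"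
  \<comment> \<open>The nested maximum is the distance from x to [a, b]; \<open>hs k\<close> is 1 on
    [a, b] and decreases with slope k + 1 in that distance. As the slope is at least 1, all
    \<open>hs k\<close> vanish at distance 1, which explains R.\<close>
  define hs where "hs k x = max 0 (1 - real (Suc k) * max 0 (max (a - x) (x - b)))" for k :: nat and x
  define R where "R = \<bar>a\<bar> + \<bar>b\<bar> + 1"
  have hs_cont: "continuous_on UNIV (hs k)" for k
    unfolding hs_def by (intro continuous_intros)
  have hs_v: "vanishes_beyond R (hs k)" for k
    unfolding vanishes_beyond_def
  proof (intro allI impI)
    fix x assume "R \<le> \<bar>x\<bar>"
    then have "1 \<le> max 0 (max (a - x) (x - b))" by (auto simp: R_def max_def)
    then have "1 * 1 \<le> real (Suc k) * max 0 (max (a - x) (x - b))"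
      by (intro mult_mono) auto
    then show "hs k x = 0" by (simp add: hs_def)
  qed
  have "(\<lambda>k. \<integral>x. f x * hs k x \<partial>lborel) \<longlonglongrightarrow> (\<integral>x. f x * indicator {a..b} x \<partial>lborel)"
  proof (rule L1loc_mult_convergence[OF f borel_measurable_continuous_onI[OF hs_cont] _ hs_v, where M = 1])
    show "\<bar>hs k x\<bar> \<le> 1" for k x
      by (auto simp: hs_def max_def mult_nonneg_nonneg)
    show "(\<lambda>k. hs k x) \<longlonglongrightarrow> indicator {a..b} x" for x
    proof (cases "x \<in> {a..b}")
      case True
      then have "max 0 (max (a - x) (x - b)) = 0" by (simp add: max_def)
      then show ?thesis using True by (simp only: hs_def) simp
    next
      case False
      define m where "m = max 0 (max (a - x) (x - b))"
      have m: "m > 0" using False by (auto simp: m_def max_def)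
      obtain N where N: "inverse m < real N" using reals_Archimedean2 by blast
      have "hs k x = 0" if "k \<ge> N" for k
      proof -
        have "inverse m \<le> real (Suc k)" using N that by simp
        then have "inverse m * m \<le> real (Suc k) * m" using m by (intro mult_right_mono) auto
        then show ?thesis using m by (simp add: hs_def m_def[symmetric])
      qed
      then have "eventually (\<lambda>k. hs k x = 0) sequentially"
        by (auto simp: eventually_sequentially)
      then show ?thesis using False by (simp add: tendsto_eventually)
    qed
  qed
  moreover have "(\<integral>x. f x * hs k x \<partial>lborel) = 0" for k
    by (rule cont[OF hs_cont hs_v]) (simp add: R_def)
  ultimately show "(\<integral>x. f x * indicator {a..b} x \<partial>lborel) = 0"
    by (simp add: LIMSEQ_const_iff)
qed

section \<open>Distributions with vanishing first or second derivative\<close>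

lemma functional_vanishing_on_derivatives:
  fixes T :: "(real \<Rightarrow> real) \<Rightarrow> real"
  assumes lin: "\<And>f g a b. test_fun f \<Longrightarrow> test_fun g \<Longrightarrow> T (\<lambda>x. a * f x + b * g x) = a * T f + b * T g"
    and zero: "\<And>f. test_fun f \<Longrightarrow> T (deriv f) = 0"
  obtains c where "\<And>f. test_fun f \<Longrightarrow> T f = c * (\<integral>x. f x \<partial>lborel)"
proof -
  obtain \<beta> :: "real \<Rightarrow> real" where \<beta>: "smooth \<beta>" "vanishes_beyond 1 \<beta>" "(\<integral>x. \<beta> x \<partial>lborel) = 1"
    by (rule normalized_bump_exists[OF zero_less_one])
  have t\<beta>: "test_fun \<beta>" by (rule test_funI[OF \<beta>(1,2)])
  have "T f = T \<beta> * (\<integral>x. f x \<partial>lborel)" if tf: "test_fun f" for f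
  proof -
    define I where "I = (\<integral>x. f x \<partial>lborel)"
    \<comment> \<open>Removing the mean of f with a bump of unit mass makes g the derivative of a
      test function, so T kills it. What is left of T f is the mean of f times
      \<open>T \<beta>\<close>.\<close>
    define g where "g = (\<lambda>x. 1 * f x + (- I) * \<beta> x)"
    have "test_fun g" unfolding g_def by (rule test_fun_lincomb[OF tf t\<beta>])
    then obtain R where g: "R > 0" "smooth g" "vanishes_beyond R g" by (rule test_funE)
    have "integrable lborel f" "integrable lborel \<beta>"
      using test_fun_integrable[OF L1loc_1] tf t\<beta> by auto
    then have "(\<integral>x. g x \<partial>lborel) = 0"
      using \<beta>(3) by (simp add: g_def I_def)
    then obtain F where F: "C1c R F g"
      using C1c_antiderivative[OF smooth_continuous[OF g(2)] g(3)] g(1) by auto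
    then have "deriv F = g" by (auto simp: C1c_def intro!: DERIV_imp_deriv)
    moreover have "smooth F"
      using F by (intro smooth_antiderivative[OF _ g(2)]) (auto simp: C1c_def)
    then have "test_fun F" using F by (intro test_funI) (auto simp: C1c_def)
    ultimately have "T g = 0" using zero by metis
    then show ?thesis unfolding g_def lin[OF tf t\<beta>] by (simp add: I_def)
  qed
  then show ?thesis by (rule that)
qed

lemma test_fun_DERIV: "test_fun (f :: real \<Rightarrow> real) \<Longrightarrow> (f has_real_derivative deriv f x) (at x)"
  by (auto simp: test_fun_iff_smooth smooth_derivative(2))

lemma deriv_lincomb:
  assumes "test_fun f" "test_fun g"
  shows "deriv (\<lambda>x. a * f x + b * g x) = (\<lambda>x::real. a * deriv f x + b * deriv g x)"
  by (intro ext DERIV_imp_deriv DERIV_add DERIV_cmult test_fun_DERIV assms)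

text \<open>The abstract functional lemma is applied twice, lowering the order by one each time:
  first to f \<mapsto> \<integral> w f', then, after subtracting the linear part of w, to
  integration against the remainder.\<close>

lemma second_derivative_zero_imp_affine:
  fixes w :: "real \<Rightarrow> real"
  assumes w: "L1loc w" and zero: "\<And>\<phi>. test_fun \<phi> \<Longrightarrow> (\<integral>x. w x * deriv (deriv \<phi>) x \<partial>lborel) = 0"
  obtains a b where "AE x in lborel. w x = a + b * x"
proof -
  obtain c where c: "\<And>f. test_fun f \<Longrightarrow> (\<integral>x. w x * deriv f x \<partial>lborel) = c * (\<integral>x. f x \<partial>lborel)"
  proof (rule functional_vanishing_on_derivatives[where T = "\<lambda>f. \<integral>x. w x * deriv f x \<partial>lborel"])
    show "(\<integral>x. w x * deriv (\<lambda>x. a * f x + b * g x) x \<partial>lborel) =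
        a * (\<integral>x. w x * deriv f x \<partial>lborel) + b * (\<integral>x. w x * deriv g x \<partial>lborel)"
      if "test_fun f" "test_fun g" for f g :: "real \<Rightarrow> real" and a b
      using test_fun_integrable[OF w test_fun_deriv[OF that(1)]] test_fun_integrable[OF w test_fun_deriv[OF that(2)]]
      by (simp add: deriv_lincomb[OF that] distrib_left mult.left_commute)
  qed (use zero in blast)+
  \<comment> \<open>The constant c says that w' = - c in the sense of distributions, so adding c x
    leaves a function whose distributional derivative is 0.\<close>
  define w1 where "w1 = (\<lambda>x. w x + c * x)"
  have w1: "L1loc w1"
    unfolding w1_def by (intro L1loc_add w L1loc_continuous continuous_intros)
  have w1_zero: "(\<integral>x. w1 x * deriv f x \<partial>lborel) = 0" if f: "test_fun f" for f
  proof -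
    obtain R where R: "smooth f" "vanishes_beyond R f" using f by (rule test_funE)
    have fR: "C1c R f (deriv f)" by (rule smooth_C1c[OF R])
    have "C1c R (\<lambda>x. x * f x) (\<lambda>x. 1 * f x + deriv f x * x)"
      unfolding C1c_def
    proof (intro conjI allI)
      show "((\<lambda>x. x * f x) has_real_derivative 1 * f x + deriv f x * x) (at x)" for x
        by (rule DERIV_mult[OF DERIV_ident test_fun_DERIV[OF f]])
      show "continuous_on UNIV (\<lambda>x. 1 * f x + deriv f x * x)"
        using fR C1c_continuous[OF fR] by (auto simp: C1c_def intro!: continuous_intros)
      show "vanishes_beyond R (\<lambda>x. x * f x)"
        by (rule vanishes_beyond_mult(2)[OF R(2)])
      show "vanishes_beyond R (\<lambda>x. 1 * f x + deriv f x * x)"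
        using fR unfolding C1c_def by (intro vanishes_beyond_add vanishes_beyond_mult(2)[OF R(2)] vanishes_beyond_mult(1)) auto
    qed
    from C1c_integral_deriv[OF this]
    have "(\<integral>x. f x + x * deriv f x \<partial>lborel) = 0" by (simp add: mult.commute)
    moreover have "integrable lborel f" "integrable lborel (\<lambda>x. x * deriv f x)"
      using test_fun_integrable[OF L1loc_1 f] test_fun_integrable[OF L1loc_continuous test_fun_deriv[OF f], of "\<lambda>x. x"]
      by auto
    ultimately have "(\<integral>x. f x \<partial>lborel) = - (\<integral>x. x * deriv f x \<partial>lborel)"
      by simp
    then show ?thesis
      using c[OF f] test_fun_integrable[OF w test_fun_deriv[OF f]] \<open>integrable lborel (\<lambda>x. x * deriv f x)\<close>
      by (simp add: w1_def distrib_right mult.assoc)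
  qed
  obtain d where d: "\<And>f. test_fun f \<Longrightarrow> (\<integral>x. w1 x * f x \<partial>lborel) = d * (\<integral>x. f x \<partial>lborel)"
  proof (rule functional_vanishing_on_derivatives[where T = "\<lambda>f. \<integral>x. w1 x * f x \<partial>lborel"])
    show "(\<integral>x. w1 x * (a * f x + b * g x) \<partial>lborel) =
        a * (\<integral>x. w1 x * f x \<partial>lborel) + b * (\<integral>x. w1 x * g x \<partial>lborel)"
      if "test_fun f" "test_fun g" for f g :: "real \<Rightarrow> real" and a b
      using test_fun_integrable[OF w1 that(1)] test_fun_integrable[OF w1 that(2)]
      by (simp add: distrib_left mult.left_commute)
  qed (use w1_zero in blast)+
  have "AE x in lborel. w1 x - d = 0"
  proof (rule L1loc_test_zero_imp_AE_zero)
    show "L1loc (\<lambda>x. w1 x - d)" by (intro L1loc_diff w1 L1loc_continuous continuous_intros)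
    show "(\<integral>x. (w1 x - d) * f x \<partial>lborel) = 0" if "test_fun f" for f
      using d[OF that] test_fun_integrable[OF w1 that] test_fun_integrable[OF L1loc_1 that]
      by (simp add: left_diff_distrib)
  qed
  then have "AE x in lborel. w x = d + (- c) * x"
    by eventually_elim (simp add: w1_def)
  then show ?thesis by (rule that)
qed

section \<open>Regularity and positivity of distributional solutions\<close>

lemma L1loc_Icc_integrable: "L1loc g \<Longrightarrow> integrable lborel (\<lambda>t. g t * indicator {a..b} t)"
  by (simp add: L1loc_def set_integrable_def mult.commute)

lemma L1loc_abs:
  assumes "L1loc f"
  shows "L1loc (\<lambda>x. \<bar>f x\<bar>)"
proof -
  have "integrable lborel (\<lambda>x. \<bar>indicator {a..b} x *\<^sub>R f x\<bar>)" for a b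
    using assms by (simp add: L1loc_def set_integrable_def)
  then show ?thesis
    by (simp add: L1loc_def set_integrable_def abs_mult)
qed

lemma L1loc_bounded_integrable:
  assumes g: "L1loc g" and h: "h \<in> borel_measurable borel" "\<And>t. \<bar>h t\<bar> \<le> indicator {a..b} t"
  shows "integrable lborel (\<lambda>t. g t * h t)"
proof (rule L1loc_mult_integrable[OF g h(1), of 1 "\<bar>a\<bar> + \<bar>b\<bar> + 1"])
  show "\<bar>h x\<bar> \<le> 1" for x by (rule order.trans[OF h(2) indicator_le_1])
  show "vanishes_beyond (\<bar>a\<bar> + \<bar>b\<bar> + 1) h"
    unfolding vanishes_beyond_def
  proof (intro allI impI)
    fix x assume "\<bar>a\<bar> + \<bar>b\<bar> + 1 \<le> \<bar>x\<bar>"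
    then have "x \<notin> {a..b}" by auto
    then show "h x = 0" using h(2)[of x] by simp
  qed
qed

text \<open>Used in two places: it evaluates the inner integral after Fubini in
  \<open>primitive_integral_deriv\<close>, and it reads off the value of a cutoff on its plateau
  from its derivative.\<close>

lemma integral_deriv_tails:
  assumes f: "C1c R f f'"
  shows "(\<integral>x. f' x * indicator {t..} x \<partial>lborel) = - f t"
    and "(\<integral>x. f' x * indicator {..t} x \<partial>lborel) = f t"
proof -
  have FTC: "(\<integral>x. f' x * indicator {a..b} x \<partial>lborel) = f b - f a" if "a \<le> b" for a b
    using integral_FTC_atLeastAtMost[OF that, of f f'] f
    by (auto simp: C1c_def mult.commute has_real_derivative_iff_has_vector_derivative[symmetric]
        intro: has_field_derivative_at_within continuous_on_subset)
  have v: "f x = 0" "f' x = 0" if "\<bar>R\<bar> \<le> \<bar>x\<bar>" for x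
    using f that by (auto simp: C1c_def vanishes_beyond_def)
  define S where "S = \<bar>R\<bar> + \<bar>t\<bar>"
  have "(\<lambda>x. f' x * indicator {t..} x) = (\<lambda>x. f' x * indicator {t..S} x)"
    using v(2) by (auto simp: fun_eq_iff indicator_def S_def)
  then show "(\<integral>x. f' x * indicator {t..} x \<partial>lborel) = - f t"
    using FTC[of t S] v(1)[of S] by (simp add: S_def)
  have "(\<lambda>x. f' x * indicator {..t} x) = (\<lambda>x. f' x * indicator {-S..t} x)"
    using v(2) by (auto simp: fun_eq_iff indicator_def S_def)
  then show "(\<integral>x. f' x * indicator {..t} x \<partial>lborel) = f t"
    using FTC[of "-S" t] v(1)[of "-S"] by (simp add: S_def)
qed

lemma integrable_pair_mult:
  fixes u v :: "real \<Rightarrow> real"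
  assumes u: "integrable lborel u" and v: "integrable lborel v"
  shows "integrable (lborel \<Otimes>\<^sub>M lborel) (\<lambda>(x, t). u x * v t)"
proof (rule lborel_pair.Fubini_integrable)
  have [measurable]: "u \<in> borel_measurable borel" "v \<in> borel_measurable borel"
    using u v by auto
  show "(\<lambda>(x, t). u x * v t) \<in> borel_measurable (lborel \<Otimes>\<^sub>M lborel)"
    by measurable
  show "integrable lborel (\<lambda>x. \<integral>t. norm (case (x, t) of (x, t) \<Rightarrow> u x * v t) \<partial>lborel)"
    using u by (simp add: abs_mult)
  show "AE x in lborel. integrable lborel (\<lambda>t. case (x, t) of (x, t) \<Rightarrow> u x * v t)"
    using v by simp
qed

text \<open>The kernel turns the integral of \<open>g\<close> from \<open>0\<close> to \<open>x\<close>, for either sign of \<open>x\<close>, into an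
  integral over the whole line.\<close>

definition step_kernel :: "real \<Rightarrow> real \<Rightarrow> real" where
  "step_kernel x t = indicator {0..x} t - indicator {x..<0} t"

definition primitive :: "(real \<Rightarrow> real) \<Rightarrow> real \<Rightarrow> real" where
  "primitive g x = (\<integral>t. g t * step_kernel x t \<partial>lborel)"

lemma step_kernel_measurable[measurable]: "step_kernel x \<in> borel_measurable borel"
  unfolding step_kernel_def by measurable

lemma step_kernel_bound: "\<bar>step_kernel x t\<bar> \<le> indicator {-\<bar>x\<bar>..\<bar>x\<bar>} t"
  by (auto simp: step_kernel_def indicator_def)

lemma step_kernel_integrable: "L1loc g \<Longrightarrow> integrable lborel (\<lambda>t. g t * step_kernel x t)"
  by (rule L1loc_bounded_integrable[OF _ step_kernel_measurable step_kernel_bound])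

lemma primitive_diff:
  assumes g: "L1loc g" and ab: "a \<le> b"
  shows "primitive g b - primitive g a = (\<integral>t. g t * indicator {a..b} t \<partial>lborel)"
proof -
  have "primitive g b - primitive g a = (\<integral>t. g t * step_kernel b t - g t * step_kernel a t \<partial>lborel)"
    unfolding primitive_def using step_kernel_integrable[OF g] by simp
  also have "\<dots> = (\<integral>t. g t * indicator {a..b} t \<partial>lborel)"
  proof (rule integral_cong_AE)
    show "(\<lambda>t. g t * step_kernel b t - g t * step_kernel a t) \<in> borel_measurable lborel"
      using step_kernel_integrable[OF g] by (intro borel_measurable_diff) auto
    show "(\<lambda>t. g t * indicator {a..b} t) \<in> borel_measurable lborel"
      using L1loc_Icc_integrable[OF g] by auto
    show "AE t in lborel. g t * step_kernel b t - g t * step_kernel a t = g t * indicator {a..b} t"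
      using AE_lborel_singleton[of a] AE_lborel_singleton[of b]
      by eventually_elim (use ab in \<open>auto simp: step_kernel_def indicator_def\<close>)
  qed
  finally show ?thesis .
qed

lemma primitive_continuous:
  assumes g: "L1loc g"
  shows "continuous_on UNIV (primitive g)"
proof -
  have "isCont (primitive g) x" for x
  proof -
    define a where "a = x - 1"
    define b where "b = x + 1"
    have int: "set_integrable lborel {c..d} g" for c d using g by (simp add: L1loc_def)
    have "primitive g y = primitive g a + integral {a..y} g" if "y \<in> {a..b}" for y
      using primitive_diff[OF g, of a y] that set_borel_integral_eq_integral(2)[OF int, of a y]
      by (simp add: set_lebesgue_integral_def mult.commute)
    note eq = this
    have "continuous_on {a..b} (\<lambda>y. primitive g a + integral {a..y} g)"
      by (intro continuous_on_add continuous_on_const indefinite_integral_continuous_1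
          set_borel_integral_eq_integral(1)[OF int])
    then have "continuous_on {a..b} (primitive g)"
      by (rule continuous_on_eq) (rule eq[symmetric])
    then show ?thesis
      by (rule continuous_on_interior) (simp add: a_def b_def interior_atLeastAtMost_real)
  qed
  then show ?thesis by (simp add: continuous_on_eq_continuous_at)
qed

text \<open>Integration by parts with g merely locally integrable, so \<open>primitive g\<close>
  need not be differentiable everywhere. Fubini replaces the product rule: for fixed t the kernel
  is, as a function of x, a signed indicator of a ray, over which f' integrates to a boundary
  value.\<close>

lemma primitive_integral_deriv:
  assumes g: "L1loc g" and f: "C1c R f f'" and R: "R \<ge> 0"
  shows "(\<integral>x. primitive g x * f' x \<partial>lborel) = - (\<integral>x. g x * f x \<partial>lborel)"
proof -
  \<comment> \<open>Truncation makes the double integrand integrable, with majorant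
    \<open>f' x * gR t\<close>. It changes nothing: the kernel forces |t| \<le> |x|, and f' vanishes
    beyond R.\<close>
  define gR where "gR = (\<lambda>t. g t * indicator {-R..R} t)"
  have gR: "integrable lborel gR"
    unfolding gR_def by (rule L1loc_Icc_integrable[OF g])
  then have [measurable]: "gR \<in> borel_measurable borel" by auto
  have f'c: "continuous_on UNIV f'" and f'v: "vanishes_beyond R f'" and fv: "vanishes_beyond R f"
    using f by (auto simp: C1c_def)
  have [measurable]: "f' \<in> borel_measurable borel" by (rule borel_measurable_continuous_onI[OF f'c])
  have f'int: "integrable lborel f'" by (rule continuous_integrable[OF f'c f'v])
  define F where "F = (\<lambda>(x, t). gR t * step_kernel x t * f' x)"
  have [measurable]: "(\<lambda>(x, t). step_kernel x t) \<in> borel_measurable (lborel \<Otimes>\<^sub>M lborel)"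
    unfolding step_kernel_def indicator_def of_bool_def atLeastAtMost_iff atLeastLessThan_iff
    by measurable
  have F: "integrable (lborel \<Otimes>\<^sub>M lborel) F"
  proof (rule Bochner_Integration.integrable_bound[OF integrable_pair_mult[OF f'int gR]])
    show "F \<in> borel_measurable (lborel \<Otimes>\<^sub>M lborel)"
      unfolding F_def by measurable
    have "\<bar>step_kernel x t\<bar> \<le> 1" for x t
      by (auto simp: step_kernel_def indicator_def)
    then have "\<bar>gR t * step_kernel x t * f' x\<bar> \<le> \<bar>f' x * gR t\<bar>" for x t
      using mult_left_mono[of "\<bar>step_kernel x t\<bar>" 1 "\<bar>f' x * gR t\<bar>"] by (simp add: abs_mult mult_ac)
    then show "AE x in lborel \<Otimes>\<^sub>M lborel. norm (F x) \<le> norm (case x of (x, t) \<Rightarrow> f' x * gR t)"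
      by (auto simp: F_def)
  qed
  have "(\<integral>x. \<integral>t. F (x, t) \<partial>lborel \<partial>lborel) = (\<integral>t. \<integral>x. F (x, t) \<partial>lborel \<partial>lborel)"
    using lborel_pair.Fubini_integral[of "\<lambda>x t. F (x, t)"] F by simp
  moreover have "(\<integral>t. F (x, t) \<partial>lborel) = primitive g x * f' x" for x
  proof (cases "\<bar>x\<bar> \<le> R")
    case True
    then have "gR t * step_kernel x t = g t * step_kernel x t" for t
      using True step_kernel_bound[of x t] by (cases "t \<in> {-\<bar>x\<bar>..\<bar>x\<bar>}") (auto simp: gR_def)
    then have "F (x, t) = (g t * step_kernel x t) * f' x" for t
      by (simp add: F_def)
    then show ?thesis by (simp add: primitive_def)
  next
    case False
    then have "f' x = 0" using f'v by (simp add: vanishes_beyond_def)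
    then show ?thesis by (simp add: F_def)
  qed
  moreover have "(\<integral>x. F (x, t) \<partial>lborel) = - (g t * f t)" for t
  proof -
    \<comment> \<open>For t \<ge> 0 the ray is \<open>{t..}\<close> with sign +, for t < 0 it is
      \<open>{..t}\<close> with sign -; the two boundary values have opposite signs as well, so both
      cases give - f t.\<close>
    have "(\<integral>x. f' x * step_kernel x t \<partial>lborel) = - f t"
    proof (cases "t \<ge> 0")
      case True
      then have "(\<lambda>x. f' x * step_kernel x t) = (\<lambda>x. f' x * indicator {t..} x)"
        by (simp add: fun_eq_iff step_kernel_def indicator_def)
      then show ?thesis using integral_deriv_tails(1)[OF f] by simp
    next
      case False
      then have "(\<lambda>x. f' x * step_kernel x t) = (\<lambda>x. - (f' x * indicator {..t} x))"
        by (simp add: fun_eq_iff step_kernel_def indicator_def)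
      then show ?thesis using integral_deriv_tails(2)[OF f] by simp
    qed
    then have "(\<integral>x. F (x, t) \<partial>lborel) = gR t * (- f t)"
      by (simp add: F_def mult.assoc mult.commute[of "step_kernel _ _"])
    also have "\<dots> = - (g t * f t)"
      using vanishes_beyond_indicator[OF fv, of t] by (simp add: gR_def mult.assoc)
    finally show ?thesis .
  qed
  ultimately show ?thesis by simp
qed

lemma C1c_parts:
  assumes F: "\<And>x. (F has_real_derivative F' x) (at x)" "continuous_on UNIV F'" and f: "C1c R f f'"
  shows "(\<integral>x. F x * f' x \<partial>lborel) = - (\<integral>x. F' x * f x \<partial>lborel)"
proof -
  have Fc: "continuous_on UNIV F"
    by (rule DERIV_continuous_on[OF has_field_derivative_at_within[OF F(1)]])
  have fc: "continuous_on UNIV f" "continuous_on UNIV f'" "vanishes_beyond R f" "vanishes_beyond R f'"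
    using f C1c_continuous[OF f] by (auto simp: C1c_def)
  have "C1c R (\<lambda>x. F x * f x) (\<lambda>x. F' x * f x + f' x * F x)"
    unfolding C1c_def
  proof (intro conjI allI)
    show "((\<lambda>x. F x * f x) has_real_derivative F' x * f x + f' x * F x) (at x)" for x
      using f by (intro DERIV_mult F(1)) (simp add: C1c_def)
    show "continuous_on UNIV (\<lambda>x. F' x * f x + f' x * F x)"
      by (intro continuous_intros Fc fc F)
    show "vanishes_beyond R (\<lambda>x. F x * f x)"
      by (rule vanishes_beyond_mult(2)[OF fc(3)])
    show "vanishes_beyond R (\<lambda>x. F' x * f x + f' x * F x)"
      by (rule vanishes_beyond_add[OF vanishes_beyond_mult(2)[OF fc(3)] vanishes_beyond_mult(1)[OF fc(4)]])
  qed
  from C1c_integral_deriv[OF this]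
  have "(\<integral>x. F' x * f x + F x * f' x \<partial>lborel) = 0" by (simp add: mult.commute)
  moreover have "integrable lborel (\<lambda>x. F' x * f x)" "integrable lborel (\<lambda>x. F x * f' x)"
    using L1loc_continuous_mult_integrable[OF L1loc_continuous[OF F(2)] fc(1,3)]
      L1loc_continuous_mult_integrable[OF L1loc_continuous[OF Fc] fc(2,4)] by auto
  ultimately show ?thesis by simp
qed

text \<open>Integrating g twice yields H with H'' = g as a distribution, so w - H is affine almost
  everywhere. The increment formula for q is the surviving form of w'' = g; it holds for all a \<le>
  b although q need not be differentiable everywhere.\<close>

lemma distributional_second_derivative_regular:
  assumes w: "L1loc w" and g: "L1loc g"
    and eq: "\<And>\<phi>. test_fun \<phi> \<Longrightarrow> (\<integral>x. w x * deriv (deriv \<phi>) x \<partial>lborel) = (\<integral>x. g x * \<phi> x \<partial>lborel)"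
  obtains p q where "AE x in lborel. w x = p x" "\<And>x. (p has_real_derivative q x) (at x)"
    "continuous_on UNIV q" "\<And>a b. a \<le> b \<Longrightarrow> q b - q a = (\<integral>x. g x * indicator {a..b} x \<partial>lborel)"
proof -
  obtain H where H: "\<And>x. (H has_real_derivative primitive g x) (at x)"
    by (rule antiderivative_exists[OF primitive_continuous[OF g]]) blast
  have Hc: "continuous_on UNIV H"
    by (rule DERIV_continuous_on[OF has_field_derivative_at_within[OF H]])
  obtain a b where ab: "AE x in lborel. w x - H x = a + b * x"
  proof (rule second_derivative_zero_imp_affine[of "\<lambda>x. w x - H x"])
    show "L1loc (\<lambda>x. w x - H x)" by (rule L1loc_diff[OF w L1loc_continuous[OF Hc]])
    fix \<phi> :: "real \<Rightarrow> real" assume \<phi>: "test_fun \<phi>"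
    obtain R where R: "R > 0" "smooth \<phi>" "vanishes_beyond R \<phi>" using \<phi> by (rule test_funE)
    have 1: "C1c R \<phi> (deriv \<phi>)" by (rule smooth_C1c[OF R(2,3)])
    have 2: "C1c R (deriv \<phi>) (deriv (deriv \<phi>))"
      using 1 by (intro smooth_C1c smooth_derivative(1) R) (simp add: C1c_def)
    have "(\<integral>x. H x * deriv (deriv \<phi>) x \<partial>lborel) = (\<integral>x. g x * \<phi> x \<partial>lborel)"
      using C1c_parts[OF H primitive_continuous[OF g] 2] primitive_integral_deriv[OF g 1] R by simp
    then show "(\<integral>x. (w x - H x) * deriv (deriv \<phi>) x \<partial>lborel) = 0"
      using eq[OF \<phi>] test_fun_integrable[OF w] test_fun_integrable[OF L1loc_continuous[OF Hc]]
        test_fun_deriv[OF test_fun_deriv[OF \<phi>]]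
      by (simp add: left_diff_distrib)
  qed blast
  show ?thesis
  proof (rule that[of "\<lambda>x. H x + (a + b * x)" "\<lambda>x. primitive g x + b"])
    show "AE x in lborel. w x = H x + (a + b * x)"
      using ab by eventually_elim simp
    show "((\<lambda>x. H x + (a + b * x)) has_real_derivative primitive g x + b) (at x)" for x
      by (rule DERIV_add[OF H]) (auto intro!: derivative_eq_intros)
    show "continuous_on UNIV (\<lambda>x. primitive g x + b)"
      by (intro continuous_intros primitive_continuous[OF g])
  qed (use primitive_diff[OF g] in auto)
qed

section \<open>Strict positivity of the continuous representative\<close>

lemma AE_continuous_nonneg:
  fixes p :: "real \<Rightarrow> real"
  assumes "continuous_on UNIV p" "AE x in lborel. p x \<ge> 0"
  shows "p x \<ge> 0"
proof (rule ccontr)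
  assume "\<not> p x \<ge> 0"
  then have x: "x \<in> {y. p y < 0}" by simp
  have op: "open {y. p y < 0}"
    using assms(1) by (intro open_Collect_less) auto
  then obtain e where e: "e > 0" "ball x e \<subseteq> {y. p y < 0}"
    using x open_contains_ball by blast
  have "AE y in lborel. y \<notin> {x - e<..<x + e}"
    using assms(2) by eventually_elim (use e(2) in \<open>force simp: ball_eq_greaterThanLessThan\<close>)
  then have "emeasure lborel {x - e<..<x + e} = 0"
    by (subst (asm) AE_iff_measurable[of "{x - e<..<x + e}"]) auto
  then show False using e(1) by simp
qed

text \<open>Uniqueness for the Cauchy problem under |p''| \<le> K |p|, read in integrated form. With
  M the maximum of |p| near c, integrating once gives |q| \<le> C M and integrating again gives |p|
  \<le> d C M \<le> M / 2, hence M = 0.\<close>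

lemma zero_data_locally_zero:
  fixes p q :: "real \<Rightarrow> real"
  assumes p: "\<And>x. (p has_real_derivative q x) (at x)" and K: "L1loc K" "\<And>x. K x \<ge> 0"
    and q: "\<And>a b. a \<le> b \<Longrightarrow> \<bar>q b - q a\<bar> \<le> (\<integral>x. K x * \<bar>p x\<bar> * indicator {a..b} x \<partial>lborel)"
    and zero: "p c = 0" "q c = 0"
  obtains d where "d > 0" "\<And>x. x \<in> {c - d..c + d} \<Longrightarrow> p x = 0"
proof -
  have pc: "continuous_on UNIV p"
    by (rule DERIV_continuous_on[OF has_field_derivative_at_within[OF p]])
  define C where "C = (\<integral>x. K x * indicator {c - 1..c + 1} x \<partial>lborel)"
  have C: "C \<ge> 0" unfolding C_def using K(2) by (intro Bochner_Integration.integral_nonneg) auto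
  \<comment> \<open>Small enough to stay inside the interval on which C measures K, and to make d C
    at most 1/2; the summand 1 covers C = 0.\<close>
  define d where "d = 1 / (2 * (1 + C))"
  have d: "d > 0" "d \<le> 1" "d * C \<le> 1 / 2" using C by (auto simp: d_def field_simps)
  let ?I = "{c - d..c + d}"
  have "\<exists>y\<in>?I. \<forall>x\<in>?I. \<bar>p x\<bar> \<le> \<bar>p y\<bar>"
    using d by (intro continuous_attains_sup continuous_on_rabs continuous_on_subset[OF pc]) auto
  then obtain y where y: "y \<in> ?I" "\<And>x. x \<in> ?I \<Longrightarrow> \<bar>p x\<bar> \<le> \<bar>p y\<bar>" by blast
  define M where "M = \<bar>p y\<bar>"
  have q_bound: "\<bar>q z\<bar> \<le> C * M" if z: "z \<in> ?I" for z
  proof -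
    have "\<bar>q (max c z) - q (min c z)\<bar> \<le> (\<integral>x. K x * \<bar>p x\<bar> * indicator {min c z..max c z} x \<partial>lborel)"
      by (rule q) auto
    also have "\<dots> \<le> (\<integral>x. K x * indicator {c - 1..c + 1} x * M \<partial>lborel)"
    proof (rule Bochner_Integration.integral_mono)
      have "integrable lborel (\<lambda>x. K x * (\<bar>p x\<bar> * indicator {min c z..max c z} x))"
      proof (rule L1loc_mult_integrable[OF K(1), where M = M and R = "\<bar>c\<bar> + 2"])
        show "(\<lambda>x. \<bar>p x\<bar> * indicator {min c z..max c z} x) \<in> borel_measurable borel"
          using borel_measurable_continuous_onI[OF pc] by measurable
        show "\<bar>\<bar>p x\<bar> * indicator {min c z..max c z} x\<bar> \<le> M" for x
        proof (cases "x \<in> {min c z..max c z}")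
          case True
          then have "x \<in> ?I" using z d by auto
          from y(2)[OF this] True show ?thesis by (simp add: M_def)
        qed (auto simp: M_def)
        show "vanishes_beyond (\<bar>c\<bar> + 2) (\<lambda>x. \<bar>p x\<bar> * indicator {min c z..max c z} x)"
          unfolding vanishes_beyond_def
        proof (intro allI impI)
          fix x assume "\<bar>c\<bar> + 2 \<le> \<bar>x\<bar>"
          then have "x \<notin> {min c z..max c z}" using z d by auto
          then show "\<bar>p x\<bar> * indicator {min c z..max c z} x = 0" by simp
        qed
      qed
      then show "integrable lborel (\<lambda>x. K x * \<bar>p x\<bar> * indicator {min c z..max c z} x)"
        by (simp add: mult.assoc)
      show "integrable lborel (\<lambda>x. K x * indicator {c - 1..c + 1} x * M)"
        using L1loc_Icc_integrable[OF K(1)] by simp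
      show "K x * \<bar>p x\<bar> * indicator {min c z..max c z} x \<le> K x * indicator {c - 1..c + 1} x * M" for x
      proof (cases "x \<in> {min c z..max c z}")
        case True
        then have "x \<in> ?I" "x \<in> {c - 1..c + 1}" using z d by auto
        then show ?thesis
          using True mult_left_mono[OF y(2) K(2)] by (simp add: M_def)
      next
        case False
        then show ?thesis using K(2)[of x] by (simp add: M_def)
      qed
    qed
    also have "\<dots> = C * M" by (simp add: C_def)
    finally show ?thesis using zero by (auto simp: max_def min_def split: if_splits)
  qed
  have "\<bar>p y\<bar> \<le> d * (C * M)"
  proof -
    have "norm (p y - p c) \<le> (C * M) * norm (y - c)"
    proof (rule field_differentiable_bound[of ?I p q])
      show "convex ?I" by simp
      show "(p has_field_derivative q x) (at x within ?I)" for x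
        by (rule has_field_derivative_at_within[OF p])
    qed (use q_bound y d in auto)
    also have "\<dots> \<le> (C * M) * d"
      using y(1) C by (intro mult_left_mono) (auto simp: M_def)
    finally show ?thesis using zero by (simp add: mult.commute)
  qed
  also have "\<dots> = (d * C) * M" by simp
  also have "\<dots> \<le> (1 / 2) * M" using d by (intro mult_right_mono) (auto simp: M_def)
  finally have "M = 0" by (simp add: M_def)
  then have "p x = 0" if "x \<in> ?I" for x
    using y(2)[OF that] by (simp add: M_def)
  then show ?thesis using that d(1) by blast
qed

text \<open>A zero of a nonnegative function is a minimum, so its derivative q vanishes there too
  and the Cauchy data are 0. The zero set is therefore open as well as closed, and by connectedness
  of the line it is empty or everything.\<close>

lemma nonneg_solution_positive:
  fixes p q :: "real \<Rightarrow> real"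
  assumes p: "\<And>x. (p has_real_derivative q x) (at x)"
    and K: "L1loc K" "\<And>x. K x \<ge> 0"
    and q: "\<And>a b. a \<le> b \<Longrightarrow> \<bar>q b - q a\<bar> \<le> (\<integral>x. K x * \<bar>p x\<bar> * indicator {a..b} x \<partial>lborel)"
    and nonneg: "\<And>x. p x \<ge> 0" and nz: "p z \<noteq> 0"
  shows "p x > 0"
proof (rule ccontr)
  assume "\<not> p x > 0"
  then have px: "p x = 0" using nonneg[of x] by simp
  have pc: "continuous_on UNIV p"
    by (rule DERIV_continuous_on[OF has_field_derivative_at_within[OF p]])
  have q0: "q y = 0" if "p y = 0" for y
    by (rule DERIV_local_min[OF p, of 1]) (use that nonneg in auto)
  let ?Z = "{y. p y = 0}"
  have "closed ?Z"
    using pc by (intro closed_Collect_eq) auto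
  moreover have "open ?Z"
    unfolding open_contains_ball
  proof
    fix c assume "c \<in> ?Z"
    then obtain d where "d > 0" "\<And>x. x \<in> {c - d..c + d} \<Longrightarrow> p x = 0"
      using zero_data_locally_zero[OF p K q] q0 by blast
    then show "\<exists>e>0. ball c e \<subseteq> ?Z"
      by (intro exI[of _ d]) (auto simp: ball_eq_greaterThanLessThan)
  qed
  ultimately have "?Z = {} \<or> ?Z = UNIV" unfolding clopen[symmetric] by (rule conjI)
  then show False using px nz by auto
qed

lemma L2loc_imp_L1loc:
  assumes "L2loc W"
  shows "L1loc W"
  unfolding L1loc_def set_integrable_def
proof (intro allI integrableI_bounded)
  fix a b
  have [measurable]: "W \<in> borel_measurable borel" using assms by (simp add: L2loc_def)
  show "(\<lambda>x. indicator {a..b} x *\<^sub>R W x) \<in> borel_measurable lborel" by measurable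
  have "(\<integral>\<^sup>+ x. ennreal (norm (indicator {a..b} x *\<^sub>R W x)) \<partial>lborel) \<le>
      (\<integral>\<^sup>+ x. indicator {a..b} x + ennreal ((W x)\<^sup>2) * indicator {a..b} x \<partial>lborel)"
  proof (rule nn_integral_mono)
    fix x
    have "\<bar>W x\<bar> \<le> 1 + (W x)\<^sup>2"
      using sum_power2_ge_zero[of "\<bar>W x\<bar> - 1" 0] zero_le_power2[of "W x"] by (simp add: power2_diff)
    then have "ennreal \<bar>W x\<bar> \<le> 1 + ennreal ((W x)\<^sup>2)"
      by (metis ennreal_1 ennreal_leI ennreal_plus zero_le_one zero_le_power2)
    then show "ennreal (norm (indicator {a..b} x *\<^sub>R W x)) \<le>
        indicator {a..b} x + ennreal ((W x)\<^sup>2) * indicator {a..b} x"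
      by (auto split: split_indicator)
  qed
  also have "\<dots> = emeasure lborel {a..b} + (\<integral>\<^sup>+ x. ennreal ((W x)\<^sup>2) * indicator {a..b} x \<partial>lborel)"
    by (subst nn_integral_add) auto
  also have "\<dots> < \<infinity>"
    using assms by (auto simp: L2loc_def emeasure_lborel_Icc_eq)
  finally show "(\<integral>\<^sup>+ x. ennreal (norm (indicator {a..b} x *\<^sub>R W x)) \<partial>lborel) < \<infinity>" .
qed

text \<open>The equation gives p'' = (W - E) p, so K = |W - E| controls the increments of q. That p
  is not identically 0 follows from its agreeing almost everywhere with \<psi> > 0.\<close>

lemma positive_solution_regular:
  assumes W: "L1loc W" and sol: "distr_solution W E \<psi>" and pos: "\<And>x. \<psi> x > 0"
  obtains p q where "AE x in lborel. \<psi> x = p x" "\<And>x. p x > 0"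
    "\<And>x. (p has_real_derivative q x) (at x)" "continuous_on UNIV q"
proof -
  have \<psi>: "L1loc \<psi>" and W\<psi>: "L1loc (\<lambda>x. W x * \<psi> x)"
    and weak: "\<And>\<phi>. test_fun \<phi> \<Longrightarrow> (\<integral>x. - \<psi> x * deriv (deriv \<phi>) x + (W x - E) * \<psi> x * \<phi> x \<partial>lborel) = 0"
    using sol by (auto simp: distr_solution_def)
  define g where "g = (\<lambda>x. (W x - E) * \<psi> x)"
  have g: "L1loc g"
    using L1loc_diff[OF W\<psi> L1loc_cmult[OF \<psi>]] by (simp add: g_def left_diff_distrib)
  obtain p q where pq: "AE x in lborel. \<psi> x = p x" "\<And>x. (p has_real_derivative q x) (at x)"
    "continuous_on UNIV q" "\<And>a b. a \<le> b \<Longrightarrow> q b - q a = (\<integral>x. g x * indicator {a..b} x \<partial>lborel)"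
  proof (rule distributional_second_derivative_regular[OF \<psi> g])
    fix \<phi> :: "real \<Rightarrow> real" assume \<phi>: "test_fun \<phi>"
    have "(\<integral>x. g x * \<phi> x - \<psi> x * deriv (deriv \<phi>) x \<partial>lborel) = 0"
      using weak[OF \<phi>] by (simp add: g_def)
    then show "(\<integral>x. \<psi> x * deriv (deriv \<phi>) x \<partial>lborel) = (\<integral>x. g x * \<phi> x \<partial>lborel)"
      using test_fun_integrable[OF g \<phi>] test_fun_integrable[OF \<psi> test_fun_deriv[OF test_fun_deriv[OF \<phi>]]]
      by simp
  qed blast
  have pc: "continuous_on UNIV p"
    by (rule DERIV_continuous_on[OF has_field_derivative_at_within[OF pq(2)]])
  have nonneg: "p x \<ge> 0" for x
  proof (rule AE_continuous_nonneg[OF pc])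
    show "AE x in lborel. p x \<ge> 0"
      using pq(1) by eventually_elim (metis pos less_imp_le)
  qed
  have "\<exists>z. p z \<noteq> 0"
  proof (rule ccontr)
    assume "\<not> (\<exists>z. p z \<noteq> 0)"
    then have "AE x in lborel. x \<notin> {0<..<1::real}"
      using pq(1) by (auto elim!: eventually_mono) (metis pos less_irrefl)
    then have "emeasure lborel {0<..<1::real} = 0"
      by (subst (asm) AE_iff_measurable[of "{0<..<1::real}"]) auto
    then show False by simp
  qed
  then obtain z where z: "p z \<noteq> 0" by blast
  have K: "L1loc (\<lambda>x. \<bar>W x - E\<bar>)"
    by (rule L1loc_abs[OF L1loc_diff[OF W L1loc_continuous[OF continuous_on_const]]])
  have "p x > 0" for x
  proof (rule nonneg_solution_positive[OF pq(2) _ _ _ nonneg z])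
    show "L1loc (\<lambda>x. \<bar>W x - E\<bar>)" by (rule K)
    show "\<bar>W x - E\<bar> \<ge> 0" for x by simp
    show "\<bar>q b - q a\<bar> \<le> (\<integral>x. \<bar>W x - E\<bar> * \<bar>p x\<bar> * indicator {a..b} x \<partial>lborel)" if "a \<le> b" for a b
    proof -
      have "\<bar>q b - q a\<bar> \<le> (\<integral>x. \<bar>g x * indicator {a..b} x\<bar> \<partial>lborel)"
        unfolding pq(4)[OF that] by (rule integral_abs_bound)
      also have "\<dots> = (\<integral>x. \<bar>W x - E\<bar> * \<bar>p x\<bar> * indicator {a..b} x \<partial>lborel)"
      proof (rule integral_cong_AE)
        show "(\<lambda>x. \<bar>g x * indicator {a..b} x\<bar>) \<in> borel_measurable lborel"
          using L1loc_Icc_integrable[OF g] by auto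
        have "(\<lambda>x. (\<bar>W x - E\<bar> * indicator {a..b} x) * \<bar>p x\<bar>) \<in> borel_measurable lborel"
          using borel_measurable_continuous_onI[OF pc]
          by (intro borel_measurable_times[OF borel_measurable_integrable[OF L1loc_Icc_integrable[OF K]]]) auto
        then show "(\<lambda>x. \<bar>W x - E\<bar> * \<bar>p x\<bar> * indicator {a..b} x) \<in> borel_measurable lborel"
          by (simp add: mult_ac)
        show "AE x in lborel. \<bar>g x * indicator {a..b} x\<bar> = \<bar>W x - E\<bar> * \<bar>p x\<bar> * indicator {a..b} x"
          using pq(1) by eventually_elim (simp add: g_def abs_mult)
      qed
      finally show ?thesis .
    qed
  qed
  then show ?thesis using that pq by blast
qed

section \<open>The ground-state substitution\<close>

lemma L1loc_mult_continuous:
  assumes f: "L1loc f" and h: "continuous_on UNIV h"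
  shows "L1loc (\<lambda>x. f x * h x)"
  unfolding L1loc_def set_integrable_def
proof (intro allI)
  fix a b :: real
  have "compact (h ` {a..b})"
    by (intro compact_continuous_image continuous_on_subset[OF h]) auto
  then obtain M where M: "\<And>x. x \<in> {a..b} \<Longrightarrow> \<bar>h x\<bar> \<le> M"
    unfolding compact_eq_bounded_closed bounded_real by blast
  have "integrable lborel (\<lambda>x. f x * (indicator {a..b} x * h x))"
  proof (rule L1loc_mult_integrable[OF f, where M = "max M 0" and R = "\<bar>a\<bar> + \<bar>b\<bar> + 1"])
    show "(\<lambda>x. indicator {a..b} x * h x) \<in> borel_measurable borel"
      using borel_measurable_continuous_onI[OF h] by measurable
    show "\<bar>indicator {a..b} x * h x\<bar> \<le> max M 0" for x
      using M[of x] by (cases "x \<in> {a..b}") (simp_all add: le_max_iff_disj)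
    show "vanishes_beyond (\<bar>a\<bar> + \<bar>b\<bar> + 1) (\<lambda>x. indicator {a..b} x * h x)"
      unfolding vanishes_beyond_def
    proof (intro allI impI)
      fix x assume "\<bar>a\<bar> + \<bar>b\<bar> + 1 \<le> \<bar>x\<bar>"
      then have "x \<notin> {a..b}" by auto
      then show "indicator {a..b} x * h x = 0" by simp
    qed
  qed
  then show "integrable lborel (\<lambda>x. indicator {a..b} x *\<^sub>R (f x * h x))"
    by (simp add: mult_ac)
qed

section \<open>Extending the form inequality and the weak equation to C^1 functions\<close>

lemma L1loc_square_convergence_uniform:
  fixes h :: "real \<Rightarrow> real"
  assumes f: "L1loc f" and h: "continuous_on UNIV h" "vanishes_beyond R h"
    and hs: "\<And>k. continuous_on UNIV (hs k)" "\<And>k. vanishes_beyond R (hs k)"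
    and conv: "\<And>k x. \<bar>hs k x - h x\<bar> \<le> inverse (real (Suc k))"
  shows "(\<lambda>k. \<integral>x. f x * (hs k x)\<^sup>2 \<partial>lborel) \<longlonglongrightarrow> (\<integral>x. f x * (h x)\<^sup>2 \<partial>lborel)"
proof -
  obtain M where M: "M \<ge> 0" "\<And>x. \<bar>h x\<bar> \<le> M"
    using vanishes_beyond_continuous_bounded[OF h] by blast
  show ?thesis
  proof (rule L1loc_mult_convergence[OF f, where M = "(M + 1)\<^sup>2" and R = R])
    show "(\<lambda>x. (hs k x)\<^sup>2) \<in> borel_measurable borel" for k
      by (intro borel_measurable_continuous_onI continuous_on_power hs)
    show "\<bar>(hs k x)\<^sup>2\<bar> \<le> (M + 1)\<^sup>2" for k x
    proof -
      have "inverse (real (Suc k)) \<le> 1" by (simp add: field_simps)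
      then have "\<bar>hs k x\<bar> \<le> M + 1" using conv[of k x] M(2)[of x] by linarith
      then show ?thesis using M(1) by (simp add: abs_le_square_iff[symmetric])
    qed
    show "vanishes_beyond R (\<lambda>x. (hs k x)\<^sup>2)" for k
      using hs(2) by (simp add: vanishes_beyond_def)
    show "(\<lambda>k. (hs k x)\<^sup>2) \<longlonglongrightarrow> (h x)\<^sup>2" for x
    proof (rule tendsto_power, rule LIM_zero_cancel,
        rule Lim_null_comparison[OF always_eventually LIMSEQ_inverse_real_of_nat])
      show "\<forall>k. norm (hs k x - h x) \<le> inverse (real (Suc k))"
        unfolding real_norm_def by (intro allI conv)
    qed
  qed
qed

text \<open>A real test function is inserted as a complex one. The result is split into two weighted
  integrals of squares, the kinetic one with weight 1, so that one convergence lemma handles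
  both.\<close>

lemma form_bounded_below_real_test:
  fixes \<eta> :: "real \<Rightarrow> real"
  assumes form: "form_bounded_below W E" and W: "L1loc W" and \<eta>: "test_fun \<eta>"
  shows "(\<integral>x. 1 * (deriv \<eta> x)\<^sup>2 \<partial>lborel) + (\<integral>x. (W x - E) * (\<eta> x)\<^sup>2 \<partial>lborel) \<ge> 0"
proof -
  let ?\<phi> = "\<lambda>x. complex_of_real (\<eta> x)"
  obtain D where D: "D 0 = \<eta>" "\<And>n x. (D n has_vector_derivative D (Suc n) x) (at x)"
    and bdd: "bounded {x. \<eta> x \<noteq> 0}"
    using \<eta> by (auto simp: test_fun_def)
  have "test_fun ?\<phi>"
    unfolding test_fun_def
  proof (intro conjI exI[of _ "\<lambda>n x. complex_of_real (D n x)"] allI)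
    show "((\<lambda>x. complex_of_real (D n x)) has_vector_derivative complex_of_real (D (Suc n) x)) (at x)" for n x
      by (rule has_vector_derivative_of_real[OF D(2)[folded has_real_derivative_iff_has_vector_derivative]])
  qed (use D(1) bdd in auto)
  then have le: "qform W ?\<phi> \<ge> E * l2norm_sq ?\<phi>"
    using form by (simp add: form_bounded_below_def)
  have "vector_derivative ?\<phi> (at x) = complex_of_real (deriv \<eta> x)" for x
    by (rule vector_derivative_at[OF has_vector_derivative_of_real[OF test_fun_DERIV[OF \<eta>]]])
  then have "(\<integral>x. (deriv \<eta> x)\<^sup>2 + W x * (\<eta> x)\<^sup>2 \<partial>lborel) \<ge> E * (\<integral>x. (\<eta> x)\<^sup>2 \<partial>lborel)"
    using le by (simp add: qform_def l2norm_sq_def)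
  moreover have "integrable lborel (\<lambda>x. f x * (g x)\<^sup>2)" if f: "L1loc f" and g: "test_fun g"
    for f g :: "real \<Rightarrow> real"
  proof -
    obtain R where "smooth g" "vanishes_beyond R g" using g by (rule test_funE)
    then show ?thesis
      by (intro L1loc_continuous_mult_integrable[OF f, where R = R] continuous_on_power smooth_continuous)
        (auto simp: vanishes_beyond_def)
  qed
  note this[OF W \<eta>] this[OF L1loc_1 \<eta>] this[OF L1loc_1 test_fun_deriv[OF \<eta>]]
  ultimately show ?thesis by (simp add: left_diff_distrib)
qed

text \<open>Uniform convergence of functions and of derivatives, within the common radius R + 1,
  takes both integrals to the limit. It will be applied to \<open>p u\<close>.\<close>

lemma form_bounded_below_C1c:
  assumes form: "form_bounded_below W E" and W: "L1loc W" and f: "C1c R f f'" and R: "R > 0"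
  shows "(\<integral>x. 1 * (f' x)\<^sup>2 \<partial>lborel) + (\<integral>x. (W x - E) * (f x)\<^sup>2 \<partial>lborel) \<ge> 0"
proof -
  obtain \<eta> where \<eta>: "\<And>k. smooth (\<eta> k)" "\<And>k. vanishes_beyond (R + 1) (\<eta> k)"
    "\<And>k x. \<bar>\<eta> k x - f x\<bar> \<le> inverse (real (Suc k))"
    "\<And>k x. \<bar>deriv (\<eta> k) x - f' x\<bar> \<le> inverse (real (Suc k))"
    by (rule C1c_approx_sequence[OF f R, of "R + 1"]) (simp, blast)
  have v: "vanishes_beyond (R + 1) f" "vanishes_beyond (R + 1) f'" "continuous_on UNIV f'"
    using f vanishes_beyond_mono[of R _ "R + 1"] by (auto simp: C1c_def)
  have WE: "L1loc (\<lambda>x. W x - E)"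
    by (rule L1loc_diff[OF W L1loc_continuous[OF continuous_on_const]])
  have d: "continuous_on UNIV (deriv (\<eta> k))" "vanishes_beyond (R + 1) (deriv (\<eta> k))" for k
    using smooth_C1c[OF \<eta>(1,2)] by (auto simp: C1c_def)
  have lim: "(\<lambda>k. (\<integral>x. 1 * (deriv (\<eta> k) x)\<^sup>2 \<partial>lborel) + (\<integral>x. (W x - E) * (\<eta> k x)\<^sup>2 \<partial>lborel)) \<longlonglongrightarrow>
      (\<integral>x. 1 * (f' x)\<^sup>2 \<partial>lborel) + (\<integral>x. (W x - E) * (f x)\<^sup>2 \<partial>lborel)"
    by (rule tendsto_add[OF
          L1loc_square_convergence_uniform[OF L1loc_1 v(3,2) d \<eta>(4)]
          L1loc_square_convergence_uniform[OF WE C1c_continuous[OF f] v(1) smooth_continuous[OF \<eta>(1)] \<eta>(2,3)]])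
  have "(\<integral>x. 1 * (deriv (\<eta> k) x)\<^sup>2 \<partial>lborel) + (\<integral>x. (W x - E) * (\<eta> k x)\<^sup>2 \<partial>lborel) \<ge> 0" for k
    by (rule form_bounded_below_real_test[OF form W test_funI[OF \<eta>(1,2)]])
  then show ?thesis
    by (intro LIMSEQ_le_const[OF lim]) blast
qed

text \<open>One integration by parts turns p \<phi>'' into q \<phi>'. Only the first derivative of
  the test function then occurs, so approximation reaches C^1 functions, in particular p
  u^2.\<close>

lemma weak_solution_C1c:
  assumes W: "L1loc W" and sol: "distr_solution W E \<psi>" and p: "AE x in lborel. \<psi> x = p x"
    "\<And>x. (p has_real_derivative q x) (at x)" "continuous_on UNIV q"
    and f: "C1c R f f'" and R: "R > 0"
  shows "(\<integral>x. q x * f' x \<partial>lborel) + (\<integral>x. ((W x - E) * p x) * f x \<partial>lborel) = 0"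
proof -
  have pc: "continuous_on UNIV p"
    by (rule DERIV_continuous_on[OF has_field_derivative_at_within[OF p(2)]])
  have g: "L1loc (\<lambda>x. (W x - E) * p x)"
    by (rule L1loc_mult_continuous[OF L1loc_diff[OF W L1loc_continuous[OF continuous_on_const]] pc])
  have test: "(\<integral>x. q x * deriv \<phi> x \<partial>lborel) + (\<integral>x. ((W x - E) * p x) * \<phi> x \<partial>lborel) = 0"
    if \<phi>: "test_fun \<phi>" for \<phi> :: "real \<Rightarrow> real"
  proof -
    obtain S where S: "S > 0" "smooth \<phi>" "vanishes_beyond S \<phi>" using \<phi> by (rule test_funE)
    have 1: "C1c S \<phi> (deriv \<phi>)" by (rule smooth_C1c[OF S(2,3)])
    have 2: "C1c S (deriv \<phi>) (deriv (deriv \<phi>))"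
      using 1 by (intro smooth_C1c smooth_derivative(1) S) (simp add: C1c_def)
    have int: "integrable lborel (\<lambda>x. p x * deriv (deriv \<phi>) x)" "integrable lborel (\<lambda>x. ((W x - E) * p x) * \<phi> x)"
      using test_fun_integrable[OF L1loc_continuous[OF pc] test_fun_deriv[OF test_fun_deriv[OF \<phi>]]]
        test_fun_integrable[OF g \<phi>] by auto
    have \<psi>: "L1loc \<psi>" and W\<psi>: "L1loc (\<lambda>x. W x * \<psi> x)"
      using sol by (auto simp: distr_solution_def)
    have "L1loc (\<lambda>x. (W x - E) * \<psi> x)"
      using L1loc_diff[OF W\<psi> L1loc_cmult[OF \<psi>]] by (simp add: left_diff_distrib)
    note int\<psi> = test_fun_integrable[OF \<psi> test_fun_deriv[OF test_fun_deriv[OF \<phi>]]]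
      test_fun_integrable[OF this \<phi>]
    have "0 = (\<integral>x. - \<psi> x * deriv (deriv \<phi>) x + (W x - E) * \<psi> x * \<phi> x \<partial>lborel)"
      using sol \<phi> by (simp add: distr_solution_def)
    also have "\<dots> = (\<integral>x. (W x - E) * p x * \<phi> x - p x * deriv (deriv \<phi>) x \<partial>lborel)"
    proof (rule integral_cong_AE)
      show "(\<lambda>x. - \<psi> x * deriv (deriv \<phi>) x + (W x - E) * \<psi> x * \<phi> x) \<in> borel_measurable lborel"
        using int\<psi> by (auto intro!: borel_measurable_add)
      show "(\<lambda>x. (W x - E) * p x * \<phi> x - p x * deriv (deriv \<phi>) x) \<in> borel_measurable lborel"
        using int by (auto intro!: borel_measurable_diff)
      show "AE x in lborel. - \<psi> x * deriv (deriv \<phi>) x + (W x - E) * \<psi> x * \<phi> x =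
          (W x - E) * p x * \<phi> x - p x * deriv (deriv \<phi>) x"
        using p(1) by eventually_elim simp
    qed
    also have "\<dots> = (\<integral>x. ((W x - E) * p x) * \<phi> x \<partial>lborel) + (\<integral>x. q x * deriv \<phi> x \<partial>lborel)"
      using int C1c_parts[OF p(2,3) 2] by simp
    finally show ?thesis by simp
  qed
  obtain \<eta> where \<eta>: "\<And>k. smooth (\<eta> k)" "\<And>k. vanishes_beyond (R + 1) (\<eta> k)"
    "\<And>k x. \<bar>\<eta> k x - f x\<bar> \<le> inverse (real (Suc k))"
    "\<And>k x. \<bar>deriv (\<eta> k) x - f' x\<bar> \<le> inverse (real (Suc k))"
    by (rule C1c_approx_sequence[OF f R, of "R + 1"]) (simp, blast)
  have v: "vanishes_beyond (R + 1) f" "vanishes_beyond (R + 1) f'" "continuous_on UNIV f'"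
    using f vanishes_beyond_mono[of R _ "R + 1"] by (auto simp: C1c_def)
  have d: "continuous_on UNIV (deriv (\<eta> k))" "vanishes_beyond (R + 1) (deriv (\<eta> k))" for k
    using smooth_C1c[OF \<eta>(1,2)] by (auto simp: C1c_def)
  have "(\<lambda>k. (\<integral>x. q x * deriv (\<eta> k) x \<partial>lborel) + (\<integral>x. ((W x - E) * p x) * \<eta> k x \<partial>lborel)) \<longlonglongrightarrow>
      (\<integral>x. q x * f' x \<partial>lborel) + (\<integral>x. ((W x - E) * p x) * f x \<partial>lborel)"
    by (rule tendsto_add[OF
          L1loc_mult_convergence_uniform[OF L1loc_continuous[OF p(3)] v(3,2) d \<eta>(4)]
          L1loc_mult_convergence_uniform[OF g C1c_continuous[OF f] v(1) smooth_continuous[OF \<eta>(1)] \<eta>(2,3)]])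
  then show ?thesis
    using test[OF test_funI[OF \<eta>(1,2)]] by (simp add: LIMSEQ_const_iff)
qed

text \<open>Ground-state substitution: inserting \<open>f = p u\<close> into the form and \<open>p u\<^sup>2\<close> into the weak
  equation for \<open>p\<close>, the terms containing \<open>W - E\<close> or the derivative of \<open>p\<close> cancel.\<close>

lemma ground_state_substitution:
  assumes W: "L1loc W" and V: "L1loc V" and sol: "distr_solution W E \<psi>"
    and p: "AE x in lborel. \<psi> x = p x"
    "\<And>x. (p has_real_derivative q x) (at x)" "continuous_on UNIV q"
    and form: "form_bounded_below (\<lambda>x. W x + V x) E"
    and u: "C1c R u u'" and R: "R > 0"
  shows "(\<integral>x. (p x * u' x)\<^sup>2 \<partial>lborel) + (\<integral>x. V x * (p x * u x)\<^sup>2 \<partial>lborel) \<ge> 0"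
proof -
  have pc: "continuous_on UNIV p"
    by (rule DERIV_continuous_on[OF has_field_derivative_at_within[OF p(2)]])
  have uc: "continuous_on UNIV u" "continuous_on UNIV u'" "vanishes_beyond R u" "vanishes_beyond R u'"
    and ud: "\<And>x. (u has_real_derivative u' x) (at x)"
    using u C1c_continuous[OF u] by (auto simp: C1c_def)
  have uv: "u x = 0" "u' x = 0" if "R \<le> \<bar>x\<bar>" for x
    using uc(3,4) that by (simp_all add: vanishes_beyond_def)
  define f where "f x = p x * u x" for x
  define f' where "f' x = q x * u x + u' x * p x" for x
  define \<phi> where "\<phi> x = f x * u x" for x
  define \<phi>' where "\<phi>' x = f' x * u x + u' x * f x" for x
  have f: "C1c R f f'"
    unfolding C1c_def f_def[abs_def] f'_def[abs_def]
  proof (intro conjI allI)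
    show "((\<lambda>x. p x * u x) has_real_derivative q x * u x + u' x * p x) (at x)" for x
      by (rule DERIV_mult[OF p(2) ud])
    show "continuous_on UNIV (\<lambda>x. q x * u x + u' x * p x)"
      by (intro continuous_on_add continuous_on_mult p(3) pc uc)
  qed (auto simp: vanishes_beyond_def uv)
  have fc: "continuous_on UNIV f" "continuous_on UNIV f'" and fd: "\<And>x. (f has_real_derivative f' x) (at x)"
    using f C1c_continuous[OF f] by (auto simp: C1c_def)
  have \<phi>: "C1c R \<phi> \<phi>'"
    unfolding C1c_def \<phi>_def[abs_def] \<phi>'_def[abs_def]
  proof (intro conjI allI)
    show "((\<lambda>x. f x * u x) has_real_derivative f' x * u x + u' x * f x) (at x)" for x
      by (rule DERIV_mult[OF fd ud])
    show "continuous_on UNIV (\<lambda>x. f' x * u x + u' x * f x)"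
      by (intro continuous_on_add continuous_on_mult fc uc)
  qed (auto simp: vanishes_beyond_def uv)
  have WE: "L1loc (\<lambda>x. W x - E)"
    by (rule L1loc_diff[OF W L1loc_continuous[OF continuous_on_const]])
  have int_pu: "integrable lborel (\<lambda>x. (p x * u' x)\<^sup>2)"
    by (rule continuous_integrable[of _ R])
      (auto intro!: continuous_intros pc uc simp: vanishes_beyond_def uv)
  have int_q: "integrable lborel (\<lambda>x. q x * \<phi>' x)"
    by (rule L1loc_continuous_mult_integrable[OF L1loc_continuous[OF p(3)], of _ R])
      (use \<phi> in \<open>auto simp: C1c_def\<close>)
  have int_f: "integrable lborel (\<lambda>x. h x * (f x)\<^sup>2)" if "L1loc h" for h
    by (rule L1loc_continuous_mult_integrable[OF that, of _ R])
      (auto intro!: continuous_intros pc uc simp: vanishes_beyond_def f_def uv)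
  \<comment> \<open>Jacobi's identity: (p u)'^2 = (p u')^2 + p' (p u^2)' pointwise, with q = p' and
    \<phi> = p u^2.\<close>
  have "(\<integral>x. 1 * (f' x)\<^sup>2 \<partial>lborel) = (\<integral>x. (p x * u' x)\<^sup>2 + q x * \<phi>' x \<partial>lborel)"
    by (intro Bochner_Integration.integral_cong refl)
      (simp add: f'_def \<phi>'_def f_def power2_eq_square algebra_simps)
  also have "\<dots> = (\<integral>x. (p x * u' x)\<^sup>2 \<partial>lborel) + (\<integral>x. q x * \<phi>' x \<partial>lborel)"
    using int_pu int_q by simp
  finally have kinetic: "(\<integral>x. 1 * (f' x)\<^sup>2 \<partial>lborel) = \<dots>" .
  have "(\<integral>x. (W x + V x - E) * (f x)\<^sup>2 \<partial>lborel) =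
      (\<integral>x. (W x - E) * (f x)\<^sup>2 + V x * (f x)\<^sup>2 \<partial>lborel)"
    by (intro Bochner_Integration.integral_cong refl) (simp add: algebra_simps)
  also have "\<dots> = (\<integral>x. (W x - E) * (f x)\<^sup>2 \<partial>lborel) + (\<integral>x. V x * (f x)\<^sup>2 \<partial>lborel)"
    using int_f[OF WE] int_f[OF V] by simp
  also have "(\<integral>x. (W x - E) * (f x)\<^sup>2 \<partial>lborel) = (\<integral>x. ((W x - E) * p x) * \<phi> x \<partial>lborel)"
    by (intro Bochner_Integration.integral_cong refl) (simp add: \<phi>_def f_def power2_eq_square)
  finally have potential: "(\<integral>x. (W x + V x - E) * (f x)\<^sup>2 \<partial>lborel) =
      (\<integral>x. ((W x - E) * p x) * \<phi> x \<partial>lborel) + (\<integral>x. V x * (f x)\<^sup>2 \<partial>lborel)" .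
  show ?thesis
    using form_bounded_below_C1c[OF form L1loc_add[OF W V] f R] weak_solution_C1c[OF W sol p \<phi> R]
    unfolding kinetic potential by (simp add: f_def)
qed

section \<open>Null-criticality\<close>

text \<open>Since the integral of \<open>p\<^sup>-\<^sup>2\<close> diverges at infinity, there are weights \<open>w\<close>, proportional
  to a truncation of \<open>p\<^sup>-\<^sup>2\<close>, of unit mass and arbitrarily small energy.\<close>

lemma one_sided_weight:
  fixes p :: "real \<Rightarrow> real"
  assumes pc: "continuous_on UNIV p" and pos: "\<And>x. p x > 0"
    and inf: "(\<integral>\<^sup>+ t\<in>{0..}. ennreal (1 / (p t)\<^sup>2) \<partial>lborel) = \<infinity>" and a: "a \<ge> 0" and e: "e > 0"
  obtains w b where "continuous_on UNIV w" "b > a" "\<And>x. x \<le> a \<or> b \<le> x \<Longrightarrow> w x = 0"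
    "(\<integral>x. w x \<partial>lborel) = 1" "(\<integral>x. (p x * w x)\<^sup>2 \<partial>lborel) \<le> e"
proof -
  define m where "m x = 1 / (p x)\<^sup>2" for x
  have m_pos: "m x > 0" for x using pos[of x] by (simp add: m_def)
  have pm: "(p x)\<^sup>2 * m x = 1" for x using pos[of x] by (simp add: m_def)
  have mc: "continuous_on UNIV m"
    unfolding m_def[abs_def] using pos by (intro continuous_intros pc) (auto simp: less_imp_neq[symmetric])
  have [measurable]: "m \<in> borel_measurable borel" by (rule borel_measurable_continuous_onI[OF mc])
  have m_int: "integrable lborel (\<lambda>t. m t * indicator {c..d} t)" for c d
    by (rule L1loc_Icc_integrable[OF L1loc_continuous[OF mc]])
  have m_nn: "(\<integral>\<^sup>+ t. ennreal (m t) * indicator {c..d} t \<partial>lborel) = ennreal (\<integral>t. m t * indicator {c..d} t \<partial>lborel)" for c d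
  proof -
    have "(\<integral>\<^sup>+ t. ennreal (m t) * indicator {c..d} t \<partial>lborel) = (\<integral>\<^sup>+ t. ennreal (m t * indicator {c..d} t) \<partial>lborel)"
      by (intro nn_integral_cong) (auto split: split_indicator)
    also have "\<dots> = ennreal (\<integral>t. m t * indicator {c..d} t \<partial>lborel)"
      using m_pos by (intro nn_integral_eq_integral m_int AE_I2) (auto simp: less_imp_le)
    finally show ?thesis .
  qed
  \<comment> \<open>Discarding the finite mass over [0, a + 1] keeps the integral infinite; the
    interval [a, a + 1] is reserved for a ramp.\<close>
  have tail: "(\<integral>\<^sup>+ t. ennreal (m t) * indicator {a + 1..} t \<partial>lborel) = \<infinity>"
  proof -
    have "\<infinity> = (\<integral>\<^sup>+ t. ennreal (m t) * indicator {0..} t \<partial>lborel)"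
      using inf by (simp add: m_def)
    also have "\<dots> \<le> (\<integral>\<^sup>+ t. ennreal (m t) * indicator {0..a + 1} t + ennreal (m t) * indicator {a + 1..} t \<partial>lborel)"
      by (intro nn_integral_mono) (auto split: split_indicator)
    also have "\<dots> = ennreal (\<integral>t. m t * indicator {0..a + 1} t \<partial>lborel) +
        (\<integral>\<^sup>+ t. ennreal (m t) * indicator {a + 1..} t \<partial>lborel)"
      by (subst nn_integral_add) (auto simp: m_nn)
    finally show ?thesis by (auto simp: top_unique)
  qed
  \<comment> \<open>The normalised weight will have energy at most the reciprocal of the mass it
    truncates, so a mass above 1 / e is required.\<close>
  have "\<exists>n. ennreal (1 / e) < (\<integral>\<^sup>+ t. ennreal (m t) * indicator {a + 1..a + 1 + real n} t \<partial>lborel)"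
  proof -
    let ?M = "density lborel (\<lambda>t. ennreal (m t))" and ?A = "\<lambda>n. {a + 1..a + 1 + real n}"
    have "(\<Union>n. ?A n) = {a + 1..}"
    proof (intro equalityI subsetI)
      fix x assume "x \<in> {a + 1..}"
      moreover obtain n where "x - (a + 1) \<le> real n" using real_arch_simple by blast
      ultimately show "x \<in> (\<Union>n. ?A n)" by (auto simp: algebra_simps intro!: exI[of _ n])
    qed auto
    moreover have "(SUP n. emeasure ?M (?A n)) = emeasure ?M (\<Union>n. ?A n)"
      by (rule SUP_emeasure_incseq) (auto simp: incseq_def)
    moreover have "emeasure ?M {a + 1..} = \<infinity>"
      using tail by (simp add: emeasure_density)
    ultimately have "(SUP n. emeasure ?M (?A n)) = \<infinity>" by metis
    then have "ennreal (1 / e) < (SUP n. emeasure ?M (?A n))" by (simp only: infinity_ennreal_def ennreal_less_top)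
    then obtain n where "ennreal (1 / e) < emeasure ?M (?A n)" by (auto simp: less_SUP_iff)
    then show ?thesis by (auto simp: emeasure_density)
  qed
  then obtain n where "ennreal (1 / e) < ennreal (\<integral>t. m t * indicator {a + 1..a + 1 + real n} t \<partial>lborel)"
    unfolding m_nn by blast
  then have n: "1 / e < (\<integral>t. m t * indicator {a + 1..a + 1 + real n} t \<partial>lborel)"
    using e by (simp add: ennreal_less_iff)
  \<comment> \<open>The trapezoid \<kappa> has plateau [a + 1, a + 1 + n] and ramps of length 1 on
    either side, hence b = a + 2 + n. The ramps keep w continuous, so that its antiderivative is
    C^1.\<close>
  define b where "b = a + 2 + real n"
  define \<kappa> where "\<kappa> x = max 0 (min 1 (min (x - a) (b - x)))" for x
  have \<kappa>: "0 \<le> \<kappa> x" "\<kappa> x \<le> 1" for x by (auto simp: \<kappa>_def)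
  have \<kappa>0: "\<kappa> x = 0" if "x \<le> a \<or> b \<le> x" for x using that by (auto simp: \<kappa>_def)
  have \<kappa>1: "\<kappa> x = 1" if "x \<in> {a + 1..a + 1 + real n}" for x using that by (auto simp: \<kappa>_def b_def)
  have \<kappa>c: "continuous_on UNIV \<kappa>" unfolding \<kappa>_def[abs_def] by (intro continuous_intros)
  have \<kappa>v: "\<kappa> x = 0" if "b \<le> \<bar>x\<bar>" for x
    using that a by (intro \<kappa>0) (auto simp: b_def abs_if split: if_splits)
  have int: "integrable lborel (\<lambda>x. m x * \<kappa> x)"
    by (rule continuous_integrable[of _ b]) (auto intro!: continuous_intros mc \<kappa>c simp: vanishes_beyond_def \<kappa>v)
  define I where "I = (\<integral>x. m x * \<kappa> x \<partial>lborel)"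
  have "(\<integral>t. m t * indicator {a + 1..a + 1 + real n} t \<partial>lborel) \<le> I"
    unfolding I_def
  proof (rule Bochner_Integration.integral_mono[OF m_int int])
    show "m x * indicator {a + 1..a + 1 + real n} x \<le> m x * \<kappa> x" for x
      using m_pos[of x] \<kappa>[of x] \<kappa>1[of x] by (cases "x \<in> {a + 1..a + 1 + real n}") (simp_all add: less_imp_le)
  qed
  then have I: "1 / e < I" using n by simp
  moreover have "1 / e > 0" using e by simp
  ultimately have I_pos: "I > 0" by linarith
  define w where "w x = m x * \<kappa> x / I" for x
  show ?thesis
  proof (rule that)
    show wc: "continuous_on UNIV w"
      unfolding w_def[abs_def] using I_pos by (intro continuous_intros mc \<kappa>c) auto
    show "b > a" by (simp add: b_def)
    show "w x = 0" if "x \<le> a \<or> b \<le> x" for x using \<kappa>0[OF that] by (simp add: w_def)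
    show "(\<integral>x. w x \<partial>lborel) = 1" using I_pos by (simp add: w_def I_def)
    have "(\<integral>x. (p x * w x)\<^sup>2 \<partial>lborel) \<le> (\<integral>x. m x * \<kappa> x / I\<^sup>2 \<partial>lborel)"
    proof (rule Bochner_Integration.integral_mono)
      show "integrable lborel (\<lambda>x. (p x * w x)\<^sup>2)"
        by (rule continuous_integrable[of _ b])
          (use I_pos in \<open>auto intro!: continuous_intros mc \<kappa>c pc simp: vanishes_beyond_def w_def \<kappa>v\<close>)
      show "integrable lborel (\<lambda>x. m x * \<kappa> x / I\<^sup>2)" using int by simp
      show "(p x * w x)\<^sup>2 \<le> m x * \<kappa> x / I\<^sup>2" for x
      proof -
        have "(p x * w x)\<^sup>2 = ((p x)\<^sup>2 * m x) * (m x * (\<kappa> x * \<kappa> x)) / I\<^sup>2"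
          by (simp add: w_def power2_eq_square)
        also have "\<dots> = m x * (\<kappa> x * \<kappa> x) / I\<^sup>2" by (simp add: pm)
        \<comment> \<open>From 0 \<le> \<kappa> \<le> 1 one has \<kappa>^2 \<le> \<kappa>, so the
          energy is bounded by the mass I divided by I^2.\<close>
        also have "\<dots> \<le> m x * \<kappa> x / I\<^sup>2"
          using m_pos[of x] \<kappa>[of x] by (intro divide_right_mono mult_left_mono mult_left_le) auto
        finally show ?thesis .
      qed
    qed
    also have "\<dots> = 1 / I" using I_pos by (simp add: I_def[symmetric] power2_eq_square)
    also have "\<dots> \<le> e" using I I_pos e by (simp add: field_simps)
    finally show "(\<integral>x. (p x * w x)\<^sup>2 \<partial>lborel) \<le> e" .
  qed
qed

text \<open>The derivative is constructed first: a reflected weight of mass 1 to the left of -R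
  minus a weight of mass 1 to the right of R. The masses cancel, so the antiderivative has compact
  support; the weights live on disjoint sets, so their energies add.\<close>

lemma null_cutoff_exists:
  fixes p :: "real \<Rightarrow> real"
  assumes pc: "continuous_on UNIV p" and pos: "\<And>x. p x > 0"
    and right: "(\<integral>\<^sup>+ t\<in>{0..}. ennreal (1 / (p t)\<^sup>2) \<partial>lborel) = \<infinity>"
    and left: "(\<integral>\<^sup>+ t\<in>{..0}. ennreal (1 / (p t)\<^sup>2) \<partial>lborel) = \<infinity>"
    and R: "R > 0" and e: "e > 0"
  obtains S u u' where "S \<ge> R" "C1c S u u'" "\<And>x. \<bar>x\<bar> \<le> R \<Longrightarrow> u x = 1"
    "(\<integral>x. (p x * u' x)\<^sup>2 \<partial>lborel) \<le> e"
proof -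
  have e2: "e / 2 > 0" and R0: "R \<ge> 0" using e R by auto
  obtain w b where w: "continuous_on UNIV w" "b > R" "\<And>x. x \<le> R \<or> b \<le> x \<Longrightarrow> w x = 0"
    "(\<integral>x. w x \<partial>lborel) = 1" "(\<integral>x. (p x * w x)\<^sup>2 \<partial>lborel) \<le> e / 2"
    by (rule one_sided_weight[OF pc pos right R0 e2]) blast
  have pc': "continuous_on UNIV (\<lambda>x. p (- x))"
    by (rule continuous_on_compose2[OF pc]) (auto intro!: continuous_intros)
  have [measurable]: "p \<in> borel_measurable borel" by (rule borel_measurable_continuous_onI[OF pc])
  \<comment> \<open>Reflecting p turns the left end into the right one, so a single one-sided
    construction serves both.\<close>
  have "(\<integral>\<^sup>+ t\<in>{..0}. ennreal (1 / (p t)\<^sup>2) \<partial>lborel) = (\<integral>\<^sup>+ t\<in>{0..}. ennreal (1 / (p (- t))\<^sup>2) \<partial>lborel)"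
  proof -
    have "(\<integral>\<^sup>+ t\<in>{..0}. ennreal (1 / (p t)\<^sup>2) \<partial>lborel) =
        (\<integral>\<^sup>+ t. ennreal (1 / (p (0 + (- 1) * t))\<^sup>2) * indicator {..0} (0 + (- 1) * t) \<partial>lborel)"
      by (subst nn_integral_real_affine[of _ "- 1" 0]) auto
    also have "\<dots> = (\<integral>\<^sup>+ t\<in>{0..}. ennreal (1 / (p (- t))\<^sup>2) \<partial>lborel)"
      by (intro nn_integral_cong) (auto split: split_indicator)
    finally show ?thesis .
  qed
  with left have left': "(\<integral>\<^sup>+ t\<in>{0..}. ennreal (1 / (p (- t))\<^sup>2) \<partial>lborel) = \<infinity>" by simp
  obtain v c where v: "continuous_on UNIV v" "c > R" "\<And>x. x \<le> R \<or> c \<le> x \<Longrightarrow> v x = 0"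
    "(\<integral>x. v x \<partial>lborel) = 1" "(\<integral>x. (p (- x) * v x)\<^sup>2 \<partial>lborel) \<le> e / 2"
    by (rule one_sided_weight[OF pc' pos left' R0 e2]) blast
  have reflect: "(\<integral>x. f (- x) \<partial>lborel) = (\<integral>x. f x \<partial>lborel)" for f :: "real \<Rightarrow> real"
    using lborel_integral_real_affine[of "- 1" f 0] by simp
  define S where "S = max b c"
  define u' where "u' x = v (- x) - w x" for x
  have S: "S \<ge> R" "S \<ge> 0" using w(2) R by (auto simp: S_def)
  have vc: "continuous_on UNIV (\<lambda>x. v (- x))"
    by (rule continuous_on_compose2[OF v(1)]) (auto intro!: continuous_intros)
  have v0: "v (- x) = 0" if "- R \<le> x \<or> x \<le> - c" for x using that by (intro v(3)) auto
  have vw: "v (- x) = 0 \<or> w x = 0" for x using v0[of x] w(3)[of x] R by linarith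
  have outside: "v (- x) = 0" "w x = 0" if "S \<le> \<bar>x\<bar>" for x
    using that v(2) w(2) R by (auto intro!: v(3) w(3) simp: S_def abs_if split: if_splits)
  have u'c: "continuous_on UNIV u'" unfolding u'_def[abs_def] by (intro continuous_intros vc w)
  have u'v: "vanishes_beyond S u'" by (simp add: vanishes_beyond_def u'_def outside)
  have int: "integrable lborel (\<lambda>x. v (- x))" "integrable lborel w"
    by (rule continuous_integrable[of _ S]; simp add: vc w(1) vanishes_beyond_def outside)+
  have "(\<integral>x. u' x \<partial>lborel) = 0"
    using int w(4) v(4) reflect[of v] by (simp add: u'_def)
  then obtain u where u: "C1c S u u'"
    using C1c_antiderivative[OF u'c u'v _ S(2)] by blast
  show ?thesis
  proof (rule that[OF S(1) u])
    fix x :: real assume x: "\<bar>x\<bar> \<le> R"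
    \<comment> \<open>From |x| \<le> R onward the left weight is already exhausted and the whole
      right weight is still ahead, so - u(x), the integral of u' over \<open>{x..}\<close>, is
      -1.\<close>
    have "u' y * indicator {x..} y = - w y" for y
      using v0[of y] w(3)[of y] x by (auto simp: u'_def abs_le_iff split: split_indicator)
    then show "u x = 1"
      using integral_deriv_tails(1)[OF u, of x] w(4) by simp
  next
    have int2: "integrable lborel (\<lambda>x. (p x * v (- x))\<^sup>2)" "integrable lborel (\<lambda>x. (p x * w x)\<^sup>2)"
      by (rule continuous_integrable[of _ S];
          auto intro!: continuous_intros pc vc w(1) simp: vanishes_beyond_def outside)+
    have "(\<integral>x. (p x * u' x)\<^sup>2 \<partial>lborel) = (\<integral>x. (p x * v (- x))\<^sup>2 + (p x * w x)\<^sup>2 \<partial>lborel)"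
    proof (intro Bochner_Integration.integral_cong refl)
      show "(p x * u' x)\<^sup>2 = (p x * v (- x))\<^sup>2 + (p x * w x)\<^sup>2" for x
        using vw[of x] by (auto simp: u'_def)
    qed
    also have "\<dots> = (\<integral>x. (p x * v (- x))\<^sup>2 \<partial>lborel) + (\<integral>x. (p x * w x)\<^sup>2 \<partial>lborel)"
      using int2 by simp
    also have "(\<integral>x. (p x * v (- x))\<^sup>2 \<partial>lborel) = (\<integral>x. (p (- x) * v x)\<^sup>2 \<partial>lborel)"
      using reflect[of "\<lambda>x. (p (- x) * v x)\<^sup>2"] by simp
    finally show "(\<integral>x. (p x * u' x)\<^sup>2 \<partial>lborel) \<le> e" using v(5) w(5) by simp
  qed
qed

section \<open>Polarisation against cutoffs of small energy\<close>

lemma C1c_lincomb: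
  assumes f: "C1c R f f'" and g: "C1c R g g'"
  shows "C1c R (\<lambda>x. f x + t * g x) (\<lambda>x. f' x + t * g' x)"
  using f g unfolding C1c_def
  by (auto intro!: DERIV_add DERIV_cmult continuous_intros vanishes_beyond_add vanishes_beyond_mult(2))

lemma C1c_mono: "C1c r f f' \<Longrightarrow> r \<le> R \<Longrightarrow> C1c R f f'"
  unfolding C1c_def using vanishes_beyond_mono by blast

text \<open>Polarising \<open>|B u u| \<le> A u\<close>, with \<open>A\<close> the weighted Dirichlet energy and
  \<open>B u v = \<integral> V p\<^sup>2 u v\<close>, and using cutoffs of energy at most \<open>t\<^sup>2\<close> gives
  \<open>2 |B 1 \<eta>| \<le> t (1 + A \<eta>)\<close> for every \<open>t > 0\<close>.\<close>

lemma dominated_form_zero: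
  fixes p V :: "real \<Rightarrow> real"
  assumes pc: "continuous_on UNIV p" and V: "L1loc V"
    and dom: "\<And>S u u'. S > 0 \<Longrightarrow> C1c S u u' \<Longrightarrow>
      \<bar>\<integral>x. V x * (p x * u x)\<^sup>2 \<partial>lborel\<bar> \<le> (\<integral>x. (p x * u' x)\<^sup>2 \<partial>lborel)"
    and cutoff: "\<And>R e. R > 0 \<Longrightarrow> e > 0 \<Longrightarrow> \<exists>S u u'. S \<ge> R \<and> C1c S u u' \<and> (\<forall>x. \<bar>x\<bar> \<le> R \<longrightarrow> u x = 1) \<and>
      (\<integral>x. (p x * u' x)\<^sup>2 \<partial>lborel) \<le> e"
    and \<eta>: "test_fun \<eta>"
  shows "(\<integral>x. V x * (p x)\<^sup>2 * \<eta> x \<partial>lborel) = 0"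
proof -
  obtain R where R: "R > 0" "smooth \<eta>" "vanishes_beyond R \<eta>" using \<eta> by (rule test_funE)
  have \<eta>c: "C1c R \<eta> (deriv \<eta>)" by (rule smooth_C1c[OF R(2,3)])
  define A where "A f' = (\<integral>x. (p x * f' x)\<^sup>2 \<partial>lborel)" for f'
  define B where "B f g = (\<integral>x. V x * ((p x)\<^sup>2 * (f x * g x)) \<partial>lborel)" for f g
  define B0 where "B0 = (\<integral>x. V x * (p x)\<^sup>2 * \<eta> x \<partial>lborel)"
  have A_eq: "(\<integral>x. (p x)\<^sup>2 * (g x * g x) \<partial>lborel) = A g" for g
    by (simp add: A_def power_mult_distrib power2_eq_square[of "g _"])
  have A_nonneg: "A f' \<ge> 0" for f' by (simp add: A_def)
  have key: "2 * \<bar>B0\<bar> \<le> t * (1 + A (deriv \<eta>))" if t: "t > 0" for t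
  proof -
    have t2: "t\<^sup>2 > 0" using t by simp
    obtain S u u' where S: "S \<ge> R" and u: "C1c S u u'" "\<And>x. \<bar>x\<bar> \<le> R \<Longrightarrow> u x = 1" "A u' \<le> t\<^sup>2"
      using cutoff[OF R(1) t2] unfolding A_def by blast
    have \<eta>S: "C1c S \<eta> (deriv \<eta>)" by (rule C1c_mono[OF \<eta>c S])
    have S0: "S > 0" using S R by simp
    have cont: "continuous_on UNIV u" "continuous_on UNIV \<eta>" "continuous_on UNIV u'" "continuous_on UNIV (deriv \<eta>)"
      and van: "vanishes_beyond S u" "vanishes_beyond S \<eta>" "vanishes_beyond S u'" "vanishes_beyond S (deriv \<eta>)"
      using u(1) \<eta>S C1c_continuous[OF u(1)] C1c_continuous[OF \<eta>S] by (auto simp: C1c_def)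
    have intB: "integrable lborel (\<lambda>x. V x * ((p x)\<^sup>2 * (f x * g x)))"
      if "continuous_on UNIV f" "continuous_on UNIV g" "vanishes_beyond S f" for f g
      using that by (intro L1loc_continuous_mult_integrable[OF V, of _ S])
        (auto intro!: continuous_intros pc simp: vanishes_beyond_def)
    have intA: "integrable lborel (\<lambda>x. (p x)\<^sup>2 * (f x * g x))"
      if "continuous_on UNIV f" "continuous_on UNIV g" "vanishes_beyond S f" for f g
      using that by (intro continuous_integrable[of _ S])
        (auto intro!: continuous_intros pc simp: vanishes_beyond_def)
    have expandB: "(\<integral>x. V x * (p x * (u x + s * \<eta> x))\<^sup>2 \<partial>lborel) = B u u + 2 * s * B u \<eta> + s\<^sup>2 * B \<eta> \<eta>" for s
    proof -
      have "(\<integral>x. V x * (p x * (u x + s * \<eta> x))\<^sup>2 \<partial>lborel) =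
          (\<integral>x. V x * ((p x)\<^sup>2 * (u x * u x)) + 2 * s * (V x * ((p x)\<^sup>2 * (u x * \<eta> x))) +
            s\<^sup>2 * (V x * ((p x)\<^sup>2 * (\<eta> x * \<eta> x))) \<partial>lborel)"
        by (intro Bochner_Integration.integral_cong refl) (simp add: power2_eq_square algebra_simps)
      then show ?thesis
        using intB[OF cont(1,1) van(1)] intB[OF cont(1,2) van(1)] intB[OF cont(2,2) van(2)] by (simp add: B_def)
    qed
    define C where "C = (\<integral>x. (p x)\<^sup>2 * (u' x * deriv \<eta> x) \<partial>lborel)"
    have expandA: "A (\<lambda>x. u' x + s * deriv \<eta> x) = A u' + 2 * s * C + s\<^sup>2 * A (deriv \<eta>)" for s
    proof -
      have "A (\<lambda>x. u' x + s * deriv \<eta> x) =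
          (\<integral>x. (p x)\<^sup>2 * (u' x * u' x) + 2 * s * ((p x)\<^sup>2 * (u' x * deriv \<eta> x)) +
            s\<^sup>2 * ((p x)\<^sup>2 * (deriv \<eta> x * deriv \<eta> x)) \<partial>lborel)"
        unfolding A_def
        by (intro Bochner_Integration.integral_cong refl) (simp add: power2_eq_square algebra_simps)
      also have "\<dots> = (\<integral>x. (p x)\<^sup>2 * (u' x * u' x) \<partial>lborel) + 2 * s * C +
          s\<^sup>2 * (\<integral>x. (p x)\<^sup>2 * (deriv \<eta> x * deriv \<eta> x) \<partial>lborel)"
        using intA[OF cont(3,3) van(3)] intA[OF cont(3,4) van(3)] intA[OF cont(4,4) van(4)] by (simp add: C_def)
      finally show ?thesis unfolding A_eq .
    qed
    have dom': "\<bar>B u u + 2 * s * B u \<eta> + s\<^sup>2 * B \<eta> \<eta>\<bar> \<le> A u' + 2 * s * C + s\<^sup>2 * A (deriv \<eta>)" for s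
      using dom[OF S0 C1c_lincomb[OF u(1) \<eta>S, of s]] unfolding expandB expandA[unfolded A_def] A_def .
    \<comment> \<open>The cutoff is 1 wherever \<eta> is nonzero, so the mixed term does not depend
      on the cutoff.\<close>
    have "B u \<eta> = B0"
      unfolding B_def B0_def
    proof (intro Bochner_Integration.integral_cong refl)
      fix x
      have "u x * \<eta> x = \<eta> x"
        using u(2)[of x] R(3) by (cases "\<bar>x\<bar> \<le> R") (simp_all add: vanishes_beyond_def)
      then show "V x * ((p x)\<^sup>2 * (u x * \<eta> x)) = V x * (p x)\<^sup>2 * \<eta> x" by simp
    qed
    \<comment> \<open>Taking s = t and s = - t: the difference of the two quantities inside the
      absolute values is 4 t B0, while in the sum of the right-hand sides the mixed energy C
      cancels. Hence neither C nor \<open>B u u\<close> has to be estimated.\<close>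
    then have "\<bar>B u u + 2 * (t * B0) + t\<^sup>2 * B \<eta> \<eta>\<bar> \<le> A u' + 2 * (t * C) + t\<^sup>2 * A (deriv \<eta>)"
      "\<bar>B u u - 2 * (t * B0) + t\<^sup>2 * B \<eta> \<eta>\<bar> \<le> A u' - 2 * (t * C) + t\<^sup>2 * A (deriv \<eta>)"
      using dom'[of t] dom'[of "- t"] by (simp_all add: mult.assoc)
    then have "4 * \<bar>t * B0\<bar> \<le> 2 * A u' + 2 * (t\<^sup>2 * A (deriv \<eta>))"
      by (simp only: abs_le_iff) linarith
    then have "4 * t * \<bar>B0\<bar> \<le> 2 * A u' + 2 * t\<^sup>2 * A (deriv \<eta>)"
      using t by (simp add: abs_mult)
    also have "\<dots> \<le> 2 * t\<^sup>2 + 2 * t\<^sup>2 * A (deriv \<eta>)" using u(3) by simp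
    finally have "(2 * t) * (2 * \<bar>B0\<bar>) \<le> (2 * t) * (t * (1 + A (deriv \<eta>)))"
      by (simp add: algebra_simps power2_eq_square)
    then show ?thesis using t by (simp only: mult_le_cancel_left_pos zero_less_mult_iff zero_less_numeral simp_thms)
  qed
  have "\<bar>B0\<bar> \<le> 0 + \<epsilon>" if \<epsilon>: "\<epsilon> > 0" for \<epsilon>
  proof -
    have pos: "1 + A (deriv \<eta>) > 0" using A_nonneg[of "deriv \<eta>"] by simp
    \<comment> \<open>The choice of t is uniform because the energy of \<eta> does not depend on the
      cutoff.\<close>
    have "2 * \<bar>B0\<bar> \<le> \<epsilon>"
      using key[of "\<epsilon> / (1 + A (deriv \<eta>))"] pos \<epsilon> by simp
    then show ?thesis using abs_ge_zero[of B0] by linarith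
  qed
  then have "\<bar>B0\<bar> \<le> 0" by (rule field_le_epsilon)
  then show ?thesis by (simp add: B0_def)
qed

theorem theorem4p3:
  fixes Q V \<psi> :: "real \<Rightarrow> real" and E0 :: real
  assumes Q: "L2loc Q"
    and semibdd: "bdd_below (rayleigh_vals Q)"
    and E0: "E0 = ground_energy Q"
    and sol: "distr_solution Q E0 \<psi>"
    and pos: "\<forall>x. \<psi> x > 0"
    and right: "(\<integral>\<^sup>+ t\<in>{0..}. ennreal (1 / (\<psi> t)\<^sup>2) \<partial>lborel) = \<infinity>"
    and left: "(\<integral>\<^sup>+ t\<in>{..0}. ennreal (1 / (\<psi> t)\<^sup>2) \<partial>lborel) = \<infinity>"
    and V: "L2loc V"
    and plus: "form_bounded_below (\<lambda>x. Q x + V x) E0"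
    and minus: "form_bounded_below (\<lambda>x. Q x - V x) E0"
  shows "AE x in lborel. V x = 0"
proof -
  have Q1: "L1loc Q" and V1: "L1loc V"
    using Q V by (auto intro: L2loc_imp_L1loc)
  obtain p q where p: "AE x in lborel. \<psi> x = p x" "\<And>x. p x > 0"
    "\<And>x. (p has_real_derivative q x) (at x)" "continuous_on UNIV q"
    by (rule positive_solution_regular[OF Q1 sol]) (use pos in blast)+
  have pc: "continuous_on UNIV p"
    by (rule DERIV_continuous_on[OF has_field_derivative_at_within[OF p(3)]])
  \<comment> \<open>Divergence is assumed for \<psi>, but the cutoffs are built from its C^1
    representative; the integrals see only the almost-everywhere class.\<close>
  have nn_eq: "(\<integral>\<^sup>+ t\<in>X. ennreal (1 / (\<psi> t)\<^sup>2) \<partial>lborel) = (\<integral>\<^sup>+ t\<in>X. ennreal (1 / (p t)\<^sup>2) \<partial>lborel)" for X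
    by (rule nn_integral_cong_AE) (use p(1) in eventually_elim, simp)
  have dom: "\<bar>\<integral>x. V x * (p x * u x)\<^sup>2 \<partial>lborel\<bar> \<le> (\<integral>x. (p x * u' x)\<^sup>2 \<partial>lborel)"
    if S: "S > 0" and u: "C1c S u u'" for S u u'
  proof -
    have V_neg: "L1loc (\<lambda>x. - V x)" using L1loc_cmult[OF V1, of "- 1"] by simp
    have minus': "form_bounded_below (\<lambda>x. Q x + - V x) E0" using minus by simp
    show ?thesis
      using ground_state_substitution[OF Q1 V1 sol p(1,3,4) plus u S]
        ground_state_substitution[OF Q1 V_neg sol p(1,3,4) minus' u S] by simp
  qed
  have Vp: "L1loc (\<lambda>x. V x * (p x)\<^sup>2)"
    by (intro L1loc_mult_continuous[OF V1] continuous_intros pc)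
  have "AE x in lborel. V x * (p x)\<^sup>2 = 0"
  proof (rule L1loc_test_zero_imp_AE_zero[OF Vp], rule dominated_form_zero[OF pc V1 dom])
    fix R e :: real assume "R > 0" "e > 0"
    then show "\<exists>S u u'. S \<ge> R \<and> C1c S u u' \<and> (\<forall>x. \<bar>x\<bar> \<le> R \<longrightarrow> u x = 1) \<and>
        (\<integral>x. (p x * u' x)\<^sup>2 \<partial>lborel) \<le> e"
      by (rule null_cutoff_exists[OF pc p(2) right[unfolded nn_eq] left[unfolded nn_eq]]) blast
  qed
  then show ?thesis
  proof eventually_elim
    fix x assume "V x * (p x)\<^sup>2 = 0"
    then show "V x = 0" using p(2)[of x] by simp
  qed
qed

end
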